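(* Let $k\ge1$ be an integer and let $\{B_i\}_{i\in\mathbb{N}}$ be a sequence of balls in $\mathbb{R}^k$ with $r(B_i)\to0$ as $i\to\infty$. Let $f$ be a dimension function such that $x^{-k}f(x)$ is monotonic, and suppose that for any ball $B$ in $\mathbb{R}^k$ $$\mathcal{H}^k\big(B\cap\limsup_{i\to\infty}B_i^f\big)=\mathcal{H}^k(B).$$ Then, for any ball $B$ in $\mathbb{R}^k$ $$\mathcal{H}^f\big(B\cap\limsup_{i\to\infty}B_i^k\big)=\mathcal{H}^f(B).$$
   Context: $\mathbb{R}^+=(0,\infty)$. Balls are closed Euclidean balls $B=B(x,r)=\{y\in\mathbb{R}^k: d(x,y)\le r\}$, given with a fixed centre $x$ and radius $r=r(B)>0$. A dimension function is a continuous, nondecreasing function $f:\mathbb{R}^+\to\mathbb{R}^+$ with $f(r)\to0$ as $r\to0$. For a ball $B=B(x,r)$ in $\mathbb{R}^k$, $B^f:=B(x,f(r)^{1/k})$; $B^k$ denotes this ball for the function $r\mapsto r^k$, so that $B^k=B$. For a sequence of sets, $\limsup_{i\to\infty}B_i:=\bigcap_{j=1}^\infty\bigcup_{i\ge j}B_i$. For $F\subset\mathbb{R}^k$ and $\rho>0$, let $\mathcal{H}^f_\rho(F)=\inf\sum_i f(r(B_i))$, the infimum being over all countable collections of balls $\{B_i\}$ with radii $r(B_i)\le\rho$ and $F\subset\bigcup_iB_i$. The Hausdorff $f$-measure is $\mathcal{H}^f(F)=\lim_{\rho\to0}\mathcal{H}^f_\rho(F)=\sup_{\rho>0}\mathcal{H}^f_\rho(F)$.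 $\mathcal{H}^k$ is the Hausdorff measure for the dimension function $r\mapsto r^k$. *)

theory Defs
  imports "HOL-Analysis.Analysis"
begin

text \<open>
  Functions on the positive reals are represented by total functions on \<open>real\<close>; every
  definition below looks only at their values at positive arguments.
\<close>

definition dimension_function :: "(real \<Rightarrow> real) \<Rightarrow> bool" where
  "dimension_function f \<longleftrightarrow>
     (\<forall>r>0. f r > 0) \<and> continuous_on {0<..} f \<and> mono_on {0<..} f \<and> (f \<longlongrightarrow> 0) (at_right 0)"

text \<open>
  A closed ball is given by its centre \<open>x\<close> and its radius \<open>r > 0\<close>; the set
  \<open>transformed_ball f x r\<close> is $B^f$ for $B = B(x,r)$.
\<close>

definition transformed_ball :: "(real \<Rightarrow> real) \<Rightarrow> real ^ 'n \<Rightarrow> real \<Rightarrow> (real ^ 'n) set" where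
  "transformed_ball f x r = cball x (f r powr (1 / real CARD('n)))"

lemma transformed_ball_power:
  fixes x :: "real ^ 'n"
  assumes "r > 0"
  shows "transformed_ball (\<lambda>t. t ^ CARD('n)) x r = cball x r"
  using assms by (simp add: transformed_ball_def powr_realpow [symmetric] powr_powr)

text \<open>
  The index set \<open>I\<close> lets the countable covers be finite (or empty) as well as infinite.
\<close>

definition hausdorff_premeasure ::
    "(real \<Rightarrow> real) \<Rightarrow> real \<Rightarrow> 'a::metric_space set \<Rightarrow> ennreal" where
  "hausdorff_premeasure f \<rho> F =
     Inf {\<Sum>\<^sub>\<infinity>i\<in>I. ennreal (f (r i)) | (I :: nat set) (x :: nat \<Rightarrow> 'a) (r :: nat \<Rightarrow> real).
            (\<forall>i\<in>I. 0 < r i \<and> r i \<le> \<rho>) \<and> F \<subseteq> (\<Union>i\<in>I. cball (x i) (r i))}"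

definition hausdorff_measure :: "(real \<Rightarrow> real) \<Rightarrow> 'a::metric_space set \<Rightarrow> ennreal" where
  "hausdorff_measure f F = (SUP \<rho>\<in>{0<..}. hausdorff_premeasure f \<rho> F)"

end

theory Submission
  imports Defs
begin

text \<open>
  Write \<open>k\<close> for the dimension, \<open>r\<^sub>i\<close> for the radius of \<open>B\<^sub>i\<close>, \<open>R\<^sub>i = f(r\<^sub>i)\<^sup>1\<^sup>/\<^sup>k\<close> for
  the radius of the enlarged ball, and \<open>E\<close> for the limsup of the original balls. Comparing \<open>H\<^sup>k\<close>
  with Lebesgue measure, the hypothesis says that the limsup of the enlarged balls has full Lebesgue
  measure.

  If \<open>f(t) \<le> a t\<^sup>k\<close> for small \<open>t\<close>, then \<open>R\<^sub>i \<le> L r\<^sub>i\<close> for large \<open>i\<close> and some constant \<open>L\<close>, and a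
  Vitali argument (\<open>limsup_full_if_dilates_full\<close>) shows that \<open>E\<close> already has full Lebesgue measure;
  its complement is also null for \<open>H\<^sup>f\<close>, and the claim follows by subadditivity.

  Otherwise \<open>f(t)/t\<^sup>k\<close> is nonincreasing and tends to infinity at 0, and the claim is that
  \<open>H\<^sup>f(B \<inter> E)\<close> is infinite. Suppose it is finite and fix a countable cover of \<open>B \<inter> E\<close> by small balls
  \<open>D\<^sub>j\<close> of radii \<open>s\<^sub>j\<close> whose cost, the sum of the \<open>f(s\<^sub>j)\<close>, is finite. For a set \<open>A\<close>, consider the
  cost of those \<open>D\<^sub>j\<close> that meet \<open>A\<close>, and call a ball \<open>A\<close> of radius \<open>r\<close> undercovered if \<open>K\<close> times this
  cost is less than \<open>f(r)\<close>, where \<open>K\<close> depends only on \<open>k\<close>. The heart of the proof is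
  \<open>ex_undercovered_subball\<close>: a small undercovered ball contains undercovered balls \<open>B\<^sub>i\<close> with arbitrarily
  large index. The descent starts in \<open>B\<close> itself, with a large constant in place of \<open>f(r)\<close> and a cover
  fine enough for that constant. Iterating gives nested undercovered balls \<open>B\<^bsub>i(n)\<^esub>\<close>, with \<open>i(n)\<close> tending to infinity.
  A point common to all of them lies in \<open>B \<inter> E\<close>, hence in some \<open>D\<^sub>j\<close>. This \<open>D\<^sub>j\<close> meets every
  \<open>B\<^bsub>i(n)\<^esub>\<close>, so \<open>f(s\<^sub>j) < f(r\<^bsub>i(n)\<^esub>)\<close> for all \<open>n\<close>, although the right-hand side tends to 0. Only one
  branch of the usual Cantor construction is followed, and no measure is built.

  For \<open>ex_undercovered_subball\<close>, choose inside the given ball \<open>A\<close> of radius \<open>r\<close> about \<open>8 f(r)/r\<^sup>k\<close>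
  layers of balls \<open>B\<^sub>i\<close> (\<open>ex_separated_layers\<close>). Within a layer the enlarged balls are disjoint and
  fill a fixed proportion of \<open>A\<close>; each layer lives on a much smaller scale than the earlier ones and
  stays away from their balls. The values \<open>f(r\<^sub>i)\<close> of all chosen balls then add up to at least
  \<open>2 f(r)\<close>. If no chosen ball were undercovered, each value \<open>f(r\<^sub>i)\<close> could be charged to the \<open>D\<^sub>j\<close>
  meeting \<open>B\<^sub>i\<close>. The separation of the layers bounds the charge on each \<open>D\<^sub>j\<close> by \<open>2 K f(s\<^sub>j)\<close>
  (\<open>sum_layers_touching_cball_le\<close>), so the total charge is at most \<open>2 K\<close> times the cost for \<open>A\<close>,
  which is less than \<open>2 f(r)\<close>: a contradiction.
\<close>

section \<open>Covers and Hausdorff measures\<close>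

lemma infsum_eq_nn_integral_count_space:
  fixes g :: "nat \<Rightarrow> ennreal"
  shows "infsum g I = (\<integral>\<^sup>+i. g i \<partial>count_space I)"
proof (rule antisym)
  have "infsum g I = (SUP F\<in>{F. finite F \<and> F \<subseteq> I}. sum g F)"
    by (rule nonneg_infsum_complete) simp
  also have "\<dots> \<le> (\<integral>\<^sup>+i. g i \<partial>count_space I)"
  proof (rule SUP_least)
    fix F assume F: "F \<in> {F. finite F \<and> F \<subseteq> I}"
    then have "sum g F = (\<integral>\<^sup>+i. g i * indicator F i \<partial>count_space I)"
      by (subst nn_integral_count_space'[where A = F]) (auto intro!: sum.cong)
    also have "\<dots> \<le> (\<integral>\<^sup>+i. g i \<partial>count_space I)"
      by (intro nn_integral_mono) (auto split: split_indicator)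
    finally show "sum g F \<le> (\<integral>\<^sup>+i. g i \<partial>count_space I)" .
  qed
  finally show "infsum g I \<le> (\<integral>\<^sup>+i. g i \<partial>count_space I)" .
next
  have "(\<integral>\<^sup>+i. g i \<partial>count_space I) = (\<integral>\<^sup>+i. g i * indicator I i \<partial>count_space UNIV)"
    by (subst nn_integral_count_space_indicator) auto
  also have "\<dots> = (\<Sum>i. g i * indicator I i)"
    by (rule nn_integral_count_space_nat)
  also have "\<dots> \<le> infsum g I"
  proof (rule suminf_le_const)
    fix n
    have "(\<Sum>i<n. g i * indicator I i) = sum g ({..<n} \<inter> I)"
      by (simp add: sum.inter_restrict indicator_def if_distrib cong: if_cong)
    also have "\<dots> \<le> (SUP F\<in>{F. finite F \<and> F \<subseteq> I}. sum g F)"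
      by (rule SUP_upper) auto
    also have "\<dots> = infsum g I"
      by (rule nonneg_infsum_complete[symmetric]) simp
    finally show "(\<Sum>i<n. g i * indicator I i) \<le> infsum g I" .
  qed simp
  finally show "(\<integral>\<^sup>+i. g i \<partial>count_space I) \<le> infsum g I" .
qed

text \<open>
  Covers indexed by any countable set are admissible, which makes it possible to index covers by
  centres, by pairs of centre and radius, or by a disjoint sum.
\<close>
lemma hausdorff_premeasure_le:
  fixes x :: "'i \<Rightarrow> 'a::metric_space"
  assumes K: "countable K" and r: "\<And>i. i \<in> K \<Longrightarrow> 0 < r i \<and> r i \<le> \<rho>"
    and F: "F \<subseteq> (\<Union>i\<in>K. cball (x i) (r i))"
  shows "hausdorff_premeasure f \<rho> F \<le> (\<integral>\<^sup>+i. ennreal (f (r i)) \<partial>count_space K)"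
proof -
  define I where "I = to_nat_on K ` K"
  define g where "g = from_nat_into K"
  have bij: "bij_betw g I K"
    unfolding I_def g_def using K
    by (intro bij_betw_byWitness[where f' = "to_nat_on K"]) auto
  then have img: "g ` I = K" by (simp add: bij_betw_def)
  have "hausdorff_premeasure f \<rho> F \<le> (\<Sum>\<^sub>\<infinity>i\<in>I. ennreal (f ((r \<circ> g) i)))"
    unfolding hausdorff_premeasure_def
  proof (rule Inf_lower, intro CollectI exI conjI)
    show "\<forall>i\<in>I. 0 < (r \<circ> g) i \<and> (r \<circ> g) i \<le> \<rho>" using r img by auto
    show "F \<subseteq> (\<Union>i\<in>I. cball ((x \<circ> g) i) ((r \<circ> g) i))" using F img by fastforce
  qed simp
  also have "\<dots> = (\<integral>\<^sup>+i. ennreal (f (r (g i))) \<partial>count_space I)"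
    by (simp add: infsum_eq_nn_integral_count_space)
  also have "\<dots> = (\<integral>\<^sup>+i. ennreal (f (r i)) \<partial>count_space K)"
    by (rule nn_integral_bij_count_space[OF bij])
  finally show ?thesis .
qed

lemma hausdorff_premeasure_coverE:
  fixes F :: "'a::metric_space set"
  assumes "hausdorff_premeasure f \<rho> F < top" "0 < e"
  obtains I :: "nat set" and x :: "nat \<Rightarrow> 'a" and r :: "nat \<Rightarrow> real"
  where "\<forall>i\<in>I. 0 < r i \<and> r i \<le> \<rho>" "F \<subseteq> (\<Union>i\<in>I. cball (x i) (r i))"
    "(\<integral>\<^sup>+i. ennreal (f (r i)) \<partial>count_space I) < hausdorff_premeasure f \<rho> F + ennreal e"
proof -
  have "hausdorff_premeasure f \<rho> F < hausdorff_premeasure f \<rho> F + ennreal e"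
    using assms by (cases "hausdorff_premeasure f \<rho> F")
      (auto simp: ennreal_less_iff simp flip: ennreal_plus)
  then obtain v where "v < hausdorff_premeasure f \<rho> F + ennreal e"
      and "\<exists>(I :: nat set) (x :: nat \<Rightarrow> 'a) r. v = (\<Sum>\<^sub>\<infinity>i\<in>I. ennreal (f (r i))) \<and>
            (\<forall>i\<in>I. 0 < r i \<and> r i \<le> \<rho>) \<and> F \<subseteq> (\<Union>i\<in>I. cball (x i) (r i))"
    by (subst (asm) (1) hausdorff_premeasure_def) (auto simp only: Inf_less_iff mem_Collect_eq)
  then show thesis
    using that by (metis infsum_eq_nn_integral_count_space)
qed

lemma hausdorff_premeasure_mono:
  fixes F G :: "'a::metric_space set"
  assumes "F \<subseteq> G" "\<rho>' \<le> \<rho>"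
  shows "hausdorff_premeasure f \<rho> F \<le> hausdorff_premeasure f \<rho>' G"
  unfolding hausdorff_premeasure_def
proof (rule Inf_superset_mono, clarify, goal_cases)
  case (1 _ I x r)
  then show ?case
    by (intro exI[of _ I] exI[of _ x] exI[of _ r] conjI refl) (use assms in \<open>fastforce+\<close>)
qed

lemma hausdorff_measure_mono: "F \<subseteq> G \<Longrightarrow> hausdorff_measure f F \<le> hausdorff_measure f G"
  unfolding hausdorff_measure_def by (rule SUP_mono) (auto intro: hausdorff_premeasure_mono)

lemma hausdorff_premeasure_le_measure:
  "\<rho> > 0 \<Longrightarrow> hausdorff_premeasure f \<rho> F \<le> hausdorff_measure f F"
  unfolding hausdorff_measure_def by (rule SUP_upper) auto

lemma hausdorff_measure_leI:
  assumes "\<delta> > 0" "\<And>\<rho>. 0 < \<rho> \<Longrightarrow> \<rho> < \<delta> \<Longrightarrow> hausdorff_premeasure f \<rho> F \<le> b"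
  shows "hausdorff_measure f F \<le> b"
  unfolding hausdorff_measure_def
proof (rule SUP_least)
  fix \<rho> :: real assume "\<rho> \<in> {0<..}"
  then have "hausdorff_premeasure f \<rho> F \<le> hausdorff_premeasure f (min \<rho> (\<delta> / 2)) F"
    by (intro hausdorff_premeasure_mono) auto
  also have "\<dots> \<le> b" using assms \<open>\<rho> \<in> _\<close> by (intro assms(2)) auto
  finally show "hausdorff_premeasure f \<rho> F \<le> b" .
qed

lemma hausdorff_premeasure_Un:
  fixes F G :: "'a::metric_space set"
  shows "hausdorff_premeasure f \<rho> (F \<union> G) \<le> hausdorff_premeasure f \<rho> F + hausdorff_premeasure f \<rho> G"
proof (cases "hausdorff_premeasure f \<rho> F = top \<or> hausdorff_premeasure f \<rho> G = top")
  case False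
  show ?thesis
  proof (rule ennreal_le_epsilon)
    fix e :: real assume e: "0 < e"
    have fin: "hausdorff_premeasure f \<rho> F < top" "hausdorff_premeasure f \<rho> G < top"
      using False by (auto simp: less_top)
    have "e / 2 > 0" using e by simp
    obtain I :: "nat set" and x :: "nat \<Rightarrow> 'a" and r where I: "\<forall>i\<in>I. 0 < r i \<and> r i \<le> \<rho>"
        "F \<subseteq> (\<Union>i\<in>I. cball (x i) (r i))"
        "(\<integral>\<^sup>+i. ennreal (f (r i)) \<partial>count_space I) < hausdorff_premeasure f \<rho> F + ennreal (e/2)"
      by (rule hausdorff_premeasure_coverE[OF fin(1) \<open>e / 2 > 0\<close>]) (rule that)
    obtain J :: "nat set" and y :: "nat \<Rightarrow> 'a" and s where J: "\<forall>i\<in>J. 0 < s i \<and> s i \<le> \<rho>"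
        "G \<subseteq> (\<Union>i\<in>J. cball (y i) (s i))"
        "(\<integral>\<^sup>+i. ennreal (f (s i)) \<partial>count_space J) < hausdorff_premeasure f \<rho> G + ennreal (e/2)"
      by (rule hausdorff_premeasure_coverE[OF fin(2) \<open>e / 2 > 0\<close>]) (rule that)
    define h where "h = case_sum (\<lambda>i. ennreal (f (r i))) (\<lambda>i. ennreal (f (s i)))"
    have "hausdorff_premeasure f \<rho> (F \<union> G)
          \<le> (\<integral>\<^sup>+i. ennreal (f (case_sum r s i)) \<partial>count_space (I <+> J))"
      by (rule hausdorff_premeasure_le[where x = "case_sum x y"])
         (use I(1,2) J(1,2) in \<open>auto simp: Plus_def subset_iff UN_Un\<close>)
    also have "\<dots> = (\<integral>\<^sup>+i. h i \<partial>count_space (I <+> J))"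
      by (intro nn_integral_cong) (auto simp: h_def split: sum.split)
    also have "\<dots> = (\<integral>\<^sup>+i. h i * indicator (Inl ` I) i + h i * indicator (Inr ` J) i \<partial>count_space (I <+> J))"
      by (intro nn_integral_cong) (auto simp: indicator_def)
    also have "\<dots> = (\<integral>\<^sup>+i. h i * indicator (Inl ` I) i \<partial>count_space (I <+> J))
                  + (\<integral>\<^sup>+i. h i * indicator (Inr ` J) i \<partial>count_space (I <+> J))"
      by (rule nn_integral_add) auto
    also have "(\<integral>\<^sup>+i. h i * indicator (Inl ` I) i \<partial>count_space (I <+> J)) = (\<integral>\<^sup>+i. h i * indicator (Inl ` I) i \<partial>count_space (Inl ` I))"
      by (rule nn_integral_count_space_eq) auto
    also have "\<dots> = (\<integral>\<^sup>+i. h i \<partial>count_space (Inl ` I))"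
      by (rule nn_integral_cong) auto
    also have "\<dots> = (\<integral>\<^sup>+i. h (Inl i) \<partial>count_space I)"
      by (rule nn_integral_bij_count_space[symmetric]) (auto simp: bij_betw_def)
    also have "\<dots> = (\<integral>\<^sup>+i. ennreal (f (r i)) \<partial>count_space I)"
      by (simp add: h_def)
    also have "(\<integral>\<^sup>+i. h i * indicator (Inr ` J) i \<partial>count_space (I <+> J)) = (\<integral>\<^sup>+i. h i * indicator (Inr ` J) i \<partial>count_space (Inr ` J))"
      by (rule nn_integral_count_space_eq) auto
    also have "\<dots> = (\<integral>\<^sup>+i. h i \<partial>count_space (Inr ` J))"
      by (rule nn_integral_cong) auto
    also have "\<dots> = (\<integral>\<^sup>+i. h (Inr i) \<partial>count_space J)"
      by (rule nn_integral_bij_count_space[symmetric]) (auto simp: bij_betw_def)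
    also have "\<dots> = (\<integral>\<^sup>+i. ennreal (f (s i)) \<partial>count_space J)"
      by (simp add: h_def)
    also have "(\<integral>\<^sup>+i. ennreal (f (r i)) \<partial>count_space I) + (\<integral>\<^sup>+i. ennreal (f (s i)) \<partial>count_space J)
         \<le> (hausdorff_premeasure f \<rho> F + ennreal (e/2)) + (hausdorff_premeasure f \<rho> G + ennreal (e/2))"
      using I(3) J(3) by (intro add_mono) auto
    also have "\<dots> = hausdorff_premeasure f \<rho> F + hausdorff_premeasure f \<rho> G + (ennreal (e/2) + ennreal (e/2))"
      by (simp add: ac_simps)
    also have "ennreal (e/2) + ennreal (e/2) = ennreal e"
      using e by (simp flip: ennreal_plus)
    finally show "hausdorff_premeasure f \<rho> (F \<union> G)
        \<le> hausdorff_premeasure f \<rho> F + hausdorff_premeasure f \<rho> G + ennreal e" .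
  qed
qed auto

lemma hausdorff_measure_Un:
  "hausdorff_measure f (F \<union> G) \<le> hausdorff_measure f F + hausdorff_measure f G"
  by (rule hausdorff_measure_leI[of 1])
     (auto intro!: order_trans[OF hausdorff_premeasure_Un] add_mono hausdorff_premeasure_le_measure)

lemma hausdorff_measure_le_mult:
  fixes F :: "'a::metric_space set"
  assumes "\<delta> > 0" "a > 0" and le: "\<And>r. 0 < r \<Longrightarrow> r < \<delta> \<Longrightarrow> f r \<le> a * g r"
  shows "hausdorff_measure f F \<le> ennreal a * hausdorff_measure g F"
proof (rule hausdorff_measure_leI[OF \<open>\<delta> > 0\<close>])
  fix \<rho> :: real assume \<rho>: "0 < \<rho>" "\<rho> < \<delta>"
  have "hausdorff_premeasure f \<rho> F / ennreal a \<le> hausdorff_premeasure g \<rho> F"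
    unfolding hausdorff_premeasure_def[of g]
  proof (rule Inf_greatest, clarify)
    fix I :: "nat set" and x :: "nat \<Rightarrow> 'a" and r :: "nat \<Rightarrow> real"
    assume I: "\<forall>i\<in>I. 0 < r i \<and> r i \<le> \<rho>" "F \<subseteq> (\<Union>i\<in>I. cball (x i) (r i))"
    have "hausdorff_premeasure f \<rho> F \<le> (\<integral>\<^sup>+i. ennreal (f (r i)) \<partial>count_space I)"
      by (rule hausdorff_premeasure_le) (use I in auto)
    also have "\<dots> \<le> (\<integral>\<^sup>+i. ennreal a * ennreal (g (r i)) \<partial>count_space I)"
      using I \<rho> \<open>a > 0\<close> le
      by (intro nn_integral_mono) (auto simp flip: ennreal_mult' intro!: ennreal_leI)
    also have "\<dots> = (\<integral>\<^sup>+i. ennreal (g (r i)) \<partial>count_space I) * ennreal a"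
      by (subst nn_integral_cmult) (auto simp: mult.commute)
    finally show "hausdorff_premeasure f \<rho> F / ennreal a \<le> (\<Sum>\<^sub>\<infinity>i\<in>I. ennreal (g (r i)))"
      using \<open>a > 0\<close> by (simp add: infsum_eq_nn_integral_count_space divide_le_posI_ennreal mult.commute)
  qed
  then have "hausdorff_premeasure f \<rho> F \<le> ennreal a * hausdorff_premeasure g \<rho> F"
    using mult_left_mono[of "hausdorff_premeasure f \<rho> F / ennreal a" _ "ennreal a"] \<open>a > 0\<close>
    by (simp add: ennreal_times_divide mult.commute[of "ennreal a" "hausdorff_premeasure f \<rho> F"]
        mult_divide_eq_ennreal)
  also have "\<dots> \<le> ennreal a * hausdorff_measure g F"
    using \<rho> by (intro mult_left_mono hausdorff_premeasure_le_measure) auto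
  finally show "hausdorff_premeasure f \<rho> F \<le> ennreal a * hausdorff_measure g F" .
qed

section \<open>Hausdorff measure and Lebesgue measure\<close>

lemma emeasure_UN_le_nn_integral:
  assumes [simp]: "countable I" and [measurable]: "\<And>i. i \<in> I \<Longrightarrow> X i \<in> sets M"
  shows "emeasure M (\<Union>i\<in>I. X i) \<le> (\<integral>\<^sup>+i. emeasure M (X i) \<partial>count_space I)"
proof -
  have "(\<Union>i\<in>I. X i) \<in> sets M" by (rule sets.countable_UN') auto
  then have "emeasure M (\<Union>i\<in>I. X i) = (\<integral>\<^sup>+x. indicator (\<Union>i\<in>I. X i) x \<partial>M)"
    by (rule nn_integral_indicator[symmetric])
  also have "\<dots> \<le> (\<integral>\<^sup>+x. (\<integral>\<^sup>+i. indicator (X i) x \<partial>count_space I) \<partial>M)"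
  proof (rule nn_integral_mono)
    fix x
    show "indicator (\<Union>i\<in>I. X i) x \<le> (\<integral>\<^sup>+i. indicator (X i) x \<partial>count_space I :: ennreal)"
    proof (cases "x \<in> (\<Union>i\<in>I. X i)")
      case True
      then obtain j where j: "j \<in> I" "x \<in> X j" by auto
      have "1 = (\<integral>\<^sup>+i. indicator {j} i \<partial>count_space I :: ennreal)"
        using j by (subst nn_integral_indicator) auto
      also have "\<dots> \<le> (\<integral>\<^sup>+i. indicator (X i) x \<partial>count_space I)"
        using j by (intro nn_integral_mono) (auto split: split_indicator)
      finally show ?thesis using True by simp
    qed simp
  qed
  also have "\<dots> = (\<integral>\<^sup>+i. (\<integral>\<^sup>+x. indicator (X i) x \<partial>M) \<partial>count_space I)"
    by (rule nn_integral_count_space_nn_integral) auto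
  also have "\<dots> = (\<integral>\<^sup>+i. emeasure M (X i) \<partial>count_space I)"
    by (rule nn_integral_cong) auto
  finally show ?thesis .
qed

lemma ennreal_mult_le_cancel:
  assumes "0 < w" "ennreal w * a \<le> ennreal w * b"
  shows "a \<le> b"
  using assms ennreal_mult_le_mult_iff[of "ennreal w" a b] by simp

lemma emeasure_cball_mult:
  fixes c :: "'a::euclidean_space"
  assumes "r \<ge> 0"
  shows "emeasure lborel (cball c r)
    = ennreal (unit_ball_vol (real DIM('a))) * ennreal (r ^ DIM('a))"
  using assms by (simp add: emeasure_cball ennreal_mult)

lemma lebesgue_le_hausdorff_measure:
  fixes F :: "'a::euclidean_space set"
  assumes F: "F \<in> sets borel"
  shows "emeasure lborel F
    \<le> ennreal (unit_ball_vol (real DIM('a))) * hausdorff_measure (\<lambda>t. t ^ DIM('a)) F"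
proof -
  define w where "w = unit_ball_vol (real DIM('a))"
  define h where "h = hausdorff_premeasure (\<lambda>t. t ^ DIM('a)) 1 F"
  have w: "w > 0" by (simp add: w_def)
  have "emeasure lborel F \<le> ennreal w * h"
  proof (cases "h = top")
    case False
    show ?thesis
    proof (rule ennreal_le_epsilon)
      fix e :: real assume e: "0 < e"
      then have "0 < e / w" and "h < top" using w False by (auto simp: less_top)
      obtain I :: "nat set" and x :: "nat \<Rightarrow> 'a" and r
        where I: "\<forall>i\<in>I. 0 < r i \<and> r i \<le> 1" "F \<subseteq> (\<Union>i\<in>I. cball (x i) (r i))"
          "(\<integral>\<^sup>+i. ennreal (r i ^ DIM('a)) \<partial>count_space I) < h + ennreal (e / w)"
        by (rule hausdorff_premeasure_coverE[OF \<open>h < top\<close>[unfolded h_def] \<open>0 < e / w\<close>, folded h_def]) (rule that)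
      have "emeasure lborel F \<le> emeasure lborel (\<Union>i\<in>I. cball (x i) (r i))"
        using I by (intro emeasure_mono) auto
      also have "\<dots> \<le> (\<integral>\<^sup>+i. emeasure lborel (cball (x i) (r i)) \<partial>count_space I)"
        by (rule emeasure_UN_le_nn_integral) auto
      also have "\<dots> = (\<integral>\<^sup>+i. ennreal w * ennreal (r i ^ DIM('a)) \<partial>count_space I)"
        by (rule nn_integral_cong) (auto simp: emeasure_cball_mult w_def less_imp_le I(1)[rule_format])
      also have "\<dots> = ennreal w * (\<integral>\<^sup>+i. ennreal (r i ^ DIM('a)) \<partial>count_space I)"
        by (rule nn_integral_cmult) auto
      also have "\<dots> \<le> ennreal w * (h + ennreal (e / w))"
        using I by (intro mult_left_mono) auto
      also have "\<dots> = ennreal w * h + ennreal e"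
        using w e by (simp add: distrib_left flip: ennreal_mult)
      finally show "emeasure lborel F \<le> ennreal w * h + ennreal e" .
    qed
  qed (use w in \<open>auto simp: ennreal_mult_top\<close>)
  also have "\<dots> \<le> ennreal w * hausdorff_measure (\<lambda>t. t ^ DIM('a)) F"
    unfolding h_def by (intro mult_left_mono hausdorff_premeasure_le_measure) auto
  finally show ?thesis unfolding w_def .
qed

text \<open>
  The volume bound for a packing of \<open>U\<close> by disjoint balls, in terms of the sum that enters the
  Hausdorff measure.
\<close>
lemma disjoint_cballs_hausdorff_sum:
  fixes x :: "'i \<Rightarrow> 'a::euclidean_space"
  assumes C: "countable C" "pairwise (\<lambda>i j. disjnt (cball (x i) (r i)) (cball (x j) (r j))) C"
    and r: "\<And>i. i \<in> C \<Longrightarrow> 0 < r i" and U: "\<And>i. i \<in> C \<Longrightarrow> cball (x i) (r i) \<subseteq> U" "U \<in> sets borel"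
  shows "ennreal (unit_ball_vol (real DIM('a))) * (\<integral>\<^sup>+i. ennreal (r i ^ DIM('a)) \<partial>count_space C)
    \<le> emeasure lborel U"
proof -
  have "ennreal (unit_ball_vol (real DIM('a))) * (\<integral>\<^sup>+i. ennreal (r i ^ DIM('a)) \<partial>count_space C)
      = (\<integral>\<^sup>+i. ennreal (unit_ball_vol (real DIM('a))) * ennreal (r i ^ DIM('a)) \<partial>count_space C)"
    by (rule nn_integral_cmult[symmetric]) auto
  also have "\<dots> = (\<integral>\<^sup>+i. emeasure lborel (cball (x i) (r i)) \<partial>count_space C)"
    by (rule nn_integral_cong) (auto simp: emeasure_cball_mult less_imp_le r)
  also have "\<dots> = emeasure lborel (\<Union>i\<in>C. cball (x i) (r i))"
    using C by (intro emeasure_UN_countable[symmetric])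
      (auto simp: disjoint_family_on_def pairwise_def disjnt_def)
  also have "\<dots> \<le> emeasure lborel U"
    using U by (intro emeasure_mono) auto
  finally show ?thesis .
qed

lemma negligible_subset_open:
  fixes N :: "'a::euclidean_space set"
  assumes "negligible N" "0 < e"
  obtains V where "open V" "N \<subseteq> V" "emeasure lborel V < ennreal e"
proof -
  have N: "N \<in> null_sets lebesgue" using assms by (simp add: negligible_iff_null_sets)
  then obtain V where V: "open V" "N \<subseteq> V" "emeasure lebesgue (V - N) < ennreal e"
    using sets_lebesgue_outer_open[of N e] assms by blast
  have "emeasure lborel V = emeasure lebesgue V" using V by simp
  also have "\<dots> = emeasure lebesgue (V - N)"
    using V N by (intro emeasure_Diff_null_set[symmetric]) auto
  finally show thesis using V that by metis
qed

lemma hausdorff_premeasure_negligible: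
  fixes N :: "'a::euclidean_space set"
  assumes N: "negligible N" and \<rho>: "\<rho> > 0"
  shows "hausdorff_premeasure (\<lambda>t. t ^ DIM('a)) \<rho> N = 0"
proof -
  define w where "w = unit_ball_vol (real DIM('a))"
  have w: "w > 0" by (simp add: w_def)
  have "hausdorff_premeasure (\<lambda>t. t ^ DIM('a)) \<rho> N \<le> 0 + ennreal e" if e: "e > 0" for e
  proof -
    define e' where "e' = w * (e / 5 ^ DIM('a))"
    obtain V where V: "open V" "N \<subseteq> V" "emeasure lborel V < ennreal e'"
      using negligible_subset_open[OF N, of e'] w e e'_def by auto
    have "\<exists>d. 0 < d \<and> d \<le> \<rho> / 5 \<and> cball x d \<subseteq> V" if "x \<in> N" for x
    proof -
      obtain d where "d > 0" "cball x d \<subseteq> V"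
        using V \<open>x \<in> N\<close> open_contains_cball by blast
      then show ?thesis using \<rho> by (intro exI[of _ "min d (\<rho> / 5)"]) auto
    qed
    then obtain d where d: "\<And>x. x \<in> N \<Longrightarrow> 0 < d x \<and> d x \<le> \<rho> / 5 \<and> cball x (d x) \<subseteq> V"
      by metis
    \<comment> \<open>The 5-fold dilates of a disjoint subfamily still cover \<open>N\<close>; radii at most \<open>\<rho> / 5\<close> keep them
       admissible.\<close>
    obtain C where C: "countable C" "C \<subseteq> N"
        "pairwise (\<lambda>i j. disjnt (cball i (d i)) (cball j (d j))) C"
        "N \<subseteq> (\<Union>i\<in>C. cball i (5 * d i))"
      by (rule Vitali_covering_lemma_cballs[of N "\<lambda>x. x" d N "\<rho> / 5"]) (use d in \<open>force+\<close>)
    have "hausdorff_premeasure (\<lambda>t. t ^ DIM('a)) \<rho> N \<le> (\<integral>\<^sup>+i. ennreal ((5 * d i) ^ DIM('a)) \<partial>count_space C)"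
      by (rule hausdorff_premeasure_le[where x = "\<lambda>x. x"]) (use C d in \<open>force+\<close>)
    also have "\<dots> = (\<integral>\<^sup>+i. ennreal (5 ^ DIM('a)) * ennreal (d i ^ DIM('a)) \<partial>count_space C)"
      using C d by (intro nn_integral_cong) (auto simp: power_mult_distrib ennreal_mult')
    also have "\<dots> = ennreal (5 ^ DIM('a)) * (\<integral>\<^sup>+i. ennreal (d i ^ DIM('a)) \<partial>count_space C)"
      by (rule nn_integral_cmult) auto
    also have "\<dots> \<le> ennreal (5 ^ DIM('a)) * ennreal (e / 5 ^ DIM('a))"
    proof (rule mult_left_mono)
      have "ennreal w * (\<integral>\<^sup>+i. ennreal (d i ^ DIM('a)) \<partial>count_space C) \<le> emeasure lborel V"
        unfolding w_def
        by (rule disjoint_cballs_hausdorff_sum) (use C d V in \<open>auto intro: borel_open\<close>)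
      also have "\<dots> \<le> ennreal w * ennreal (e / 5 ^ DIM('a))"
        using V(3) w e by (simp add: e'_def less_imp_le flip: ennreal_mult)
      finally show "(\<integral>\<^sup>+i. ennreal (d i ^ DIM('a)) \<partial>count_space C) \<le> ennreal (e / 5 ^ DIM('a))"
        using w by (rule ennreal_mult_le_cancel[rotated])
    qed simp
    also have "\<dots> = ennreal e"
      using e by (simp flip: ennreal_mult')
    finally show ?thesis by simp
  qed
  then have "hausdorff_premeasure (\<lambda>t. t ^ DIM('a)) \<rho> N \<le> 0"
    by (rule ennreal_le_epsilon)
  then show ?thesis by simp
qed

lemma hausdorff_measure_negligible:
  fixes N :: "'a::euclidean_space set"
  assumes "negligible N"
  shows "hausdorff_measure (\<lambda>t. t ^ DIM('a)) N = 0"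
  using assms by (simp add: hausdorff_measure_def hausdorff_premeasure_negligible)

text \<open>
  Together with \<open>lebesgue_le_hausdorff_measure\<close> this identifies \<open>H\<^sup>k\<close> with Lebesgue measure up to
  the volume of the unit ball. A Vitali packing of an open superset of \<open>F\<close> covers it efficiently up
  to a null set, and null sets cost nothing.
\<close>
lemma hausdorff_measure_le_lebesgue:
  fixes F :: "'a::euclidean_space set"
  assumes F: "F \<in> sets borel"
  shows "ennreal (unit_ball_vol (real DIM('a))) * hausdorff_measure (\<lambda>t. t ^ DIM('a)) F
    \<le> emeasure lborel F"
proof (rule ennreal_le_epsilon)
  fix e :: real assume e: "e > 0"
  define w where "w = unit_ball_vol (real DIM('a))"
  have w: "w > 0" by (simp add: w_def)
  obtain U where U: "open U" "F \<subseteq> U" "emeasure lborel (U - F) < ennreal e"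
    using outer_regular_lborel[OF F e] .
  have pre: "ennreal w * hausdorff_premeasure (\<lambda>t. t ^ DIM('a)) \<rho> F \<le> emeasure lborel U"
    if \<rho>: "\<rho> > 0" for \<rho>
  proof -
    let ?H = "hausdorff_premeasure (\<lambda>t. t ^ DIM('a)) \<rho>"
    define K where "K = {p :: 'a \<times> real. 0 < snd p \<and> snd p \<le> \<rho> \<and> cball (fst p) (snd p) \<subseteq> U}"
    have "\<exists>p. p \<in> K \<and> x \<in> cball (fst p) (snd p) \<and> snd p < d" if "x \<in> U" "0 < d" for x d
    proof -
      obtain s where "s > 0" "cball x s \<subseteq> U"
        using U \<open>x \<in> U\<close> open_contains_cball by blast
      then show ?thesis using \<rho> \<open>0 < d\<close>
        by (intro exI[of _ "(x, min s (min \<rho> (d / 2)))"]) (auto simp: K_def)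
    qed
    then obtain C where C: "countable C" "C \<subseteq> K"
       "pairwise (\<lambda>i j. disjnt (cball (fst i) (snd i)) (cball (fst j) (snd j))) C"
       "negligible (U - (\<Union>i\<in>C. cball (fst i) (snd i)))"
      by (rule Vitali_covering_theorem_cballs[of K snd U fst, rotated]) (auto simp: K_def)
    have "?H F \<le> ?H ((\<Union>i\<in>C. cball (fst i) (snd i)) \<union> (U - (\<Union>i\<in>C. cball (fst i) (snd i))))"
      using U by (intro hausdorff_premeasure_mono) auto
    also have "\<dots> \<le> ?H (\<Union>i\<in>C. cball (fst i) (snd i)) + ?H (U - (\<Union>i\<in>C. cball (fst i) (snd i)))"
      by (rule hausdorff_premeasure_Un)
    also have "?H (U - (\<Union>i\<in>C. cball (fst i) (snd i))) = 0"
      by (rule hausdorff_premeasure_negligible[OF C(4) \<rho>])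
    also have "?H (\<Union>i\<in>C. cball (fst i) (snd i)) + 0 \<le> (\<integral>\<^sup>+i. ennreal (snd i ^ DIM('a)) \<partial>count_space C)"
      unfolding add_0_right
      by (rule hausdorff_premeasure_le) (use C in \<open>auto simp: K_def\<close>)
    finally have "ennreal w * ?H F \<le> ennreal w * (\<integral>\<^sup>+i. ennreal (snd i ^ DIM('a)) \<partial>count_space C)"
      by (rule mult_left_mono) simp
    also have "\<dots> \<le> emeasure lborel U"
      unfolding w_def
      by (rule disjoint_cballs_hausdorff_sum) (use C U in \<open>auto simp: K_def intro: borel_open\<close>)
    finally show ?thesis .
  qed
  have "ennreal w * hausdorff_measure (\<lambda>t. t ^ DIM('a)) F \<le> emeasure lborel U"
    unfolding hausdorff_measure_def using pre by (subst SUP_mult_left_ennreal) (auto intro!: SUP_least)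
  also have "\<dots> = emeasure lborel (F \<union> (U - F))"
    using U by (simp add: Un_absorb1)
  also have "\<dots> \<le> emeasure lborel F + emeasure lborel (U - F)"
    using U F by (intro emeasure_subadditive) (auto intro: borel_open)
  also have "\<dots> \<le> emeasure lborel F + ennreal e"
    using U by (intro add_left_mono) auto
  finally show "ennreal (unit_ball_vol (real DIM('a))) * hausdorff_measure (\<lambda>t. t ^ DIM('a)) F
      \<le> emeasure lborel F + ennreal e" by (simp add: w_def)
qed

section \<open>Limsup sets of balls of full Lebesgue measure\<close>

lemma mem_limsup_iff: "x \<in> limsup A \<longleftrightarrow> (\<forall>N. \<exists>i\<ge>N. x \<in> A i)"
  for A :: "nat \<Rightarrow> 'a set"
  by (auto simp: limsup_INF_SUP)

lemma limsup_cball_borel: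
  fixes c :: "nat \<Rightarrow> 'a::euclidean_space"
  shows "limsup (\<lambda>i. cball (c i) (R i)) \<in> sets borel"
  by (simp add: limsup_INF_SUP)

lemma negligible_borelI:
  fixes F :: "'a::euclidean_space set"
  assumes "F \<in> sets borel" "emeasure lborel F = 0"
  shows "negligible F"
  using assms by (simp add: negligible_iff_null_sets null_sets_def)

lemma negligible_Compl_if_full_hausdorff_measure:
  fixes E :: "'a::euclidean_space set"
  assumes E: "E \<in> sets borel"
    and full: "\<And>r. r > 0 \<Longrightarrow> hausdorff_measure (\<lambda>t. t ^ DIM('a)) (cball 0 r \<inter> E)
                  = hausdorff_measure (\<lambda>t. t ^ DIM('a)) (cball (0 :: 'a) r)"
  shows "negligible (- E)"
proof -
  have "negligible (cball 0 (real (Suc n)) - E)" for n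
  proof -
    let ?B = "cball 0 (real (Suc n)) :: 'a set"
    have "emeasure lborel ?B \<le> ennreal (unit_ball_vol (real DIM('a))) * hausdorff_measure (\<lambda>t. t ^ DIM('a)) ?B"
      by (rule lebesgue_le_hausdorff_measure) auto
    also have "\<dots> = ennreal (unit_ball_vol (real DIM('a))) * hausdorff_measure (\<lambda>t. t ^ DIM('a)) (?B \<inter> E)"
      by (subst full) auto
    also have "\<dots> \<le> emeasure lborel (?B \<inter> E)"
      using E by (intro hausdorff_measure_le_lebesgue) auto
    finally have le: "emeasure lborel ?B \<le> emeasure lborel (?B \<inter> E)" .
    have fin: "emeasure lborel ?B < top"
      using emeasure_lborel_cball_finite by (simp add: top.not_eq_extremum less_top)
    have "?B - E = ?B - (?B \<inter> E)" by auto
    also have "emeasure lborel \<dots> = emeasure lborel ?B - emeasure lborel (?B \<inter> E)"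
    proof (rule emeasure_Diff)
      show "emeasure lborel (?B \<inter> E) \<noteq> \<infinity>"
        using fin emeasure_mono[of "?B \<inter> E" ?B lborel] E by auto
    qed (use E in auto)
    also have "\<dots> = 0" using le fin by (auto intro: diff_eq_0_ennreal)
    finally show ?thesis using E by (intro negligible_borelI) auto
  qed
  then have "negligible (\<Union>n. cball 0 (real (Suc n)) - E)"
    by (intro negligible_countable_Union) auto
  moreover have "- E \<subseteq> (\<Union>n. cball 0 (real (Suc n)) - E)"
  proof
    fix x assume "x \<in> - E"
    obtain n where "norm x \<le> real n" using real_arch_simple by blast
    then show "x \<in> (\<Union>n. cball 0 (real (Suc n)) - E)"
      using \<open>x \<in> - E\<close> by (intro UN_I[of n]) auto
  qed
  ultimately show ?thesis by (rule negligible_subset)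
qed

text \<open>
  Vitali's theorem for a limsup set of full measure: almost all of an open set is filled by disjoint
  balls of the sequence contained in it, with arbitrarily large indices.
\<close>
lemma vitali_limsup_cballs:
  fixes c :: "nat \<Rightarrow> 'a::euclidean_space"
  assumes R: "\<And>i. R i > 0" "R \<longlonglongrightarrow> 0"
    and full: "negligible (- limsup (\<lambda>i. cball (c i) (R i)))"
    and U: "open U"
  obtains C where "C \<subseteq> {i. N \<le> i \<and> cball (c i) (R i) \<subseteq> U}"
    "pairwise (\<lambda>i j. disjnt (cball (c i) (R i)) (cball (c j) (R j))) C"
    "emeasure lborel U
      \<le> ennreal (unit_ball_vol (real DIM('a))) * (\<integral>\<^sup>+i. ennreal (R i ^ DIM('a)) \<partial>count_space C)"
proof -
  define K where "K = {i. N \<le> i \<and> cball (c i) (R i) \<subseteq> U}"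
  let ?E = "limsup (\<lambda>i. cball (c i) (R i))"
  have "\<exists>i. i \<in> K \<and> x \<in> cball (c i) (R i) \<and> R i < d" if x: "x \<in> U \<inter> ?E" and "0 < d" for x d
  proof -
    obtain e where e: "e > 0" "ball x e \<subseteq> U"
      using U x open_contains_ball by blast
    have "\<forall>\<^sub>F i in sequentially. R i < min d (e / 2)"
      using R(2) e \<open>0 < d\<close> by (intro order_tendstoD) auto
    then obtain M where M: "\<And>i. i \<ge> M \<Longrightarrow> R i < min d (e / 2)"
      by (auto simp: eventually_sequentially)
    obtain i where i: "i \<ge> max M N" "x \<in> cball (c i) (R i)"
      using IntD2[OF x, unfolded mem_limsup_iff] by blast
    have "cball (c i) (R i) \<subseteq> ball x e"
    proof
      fix z assume "z \<in> cball (c i) (R i)"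
      then have "dist x z \<le> 2 * R i"
        using i dist_triangle[of x z "c i"] by (simp add: dist_commute)
      then show "z \<in> ball x e" using M[of i] i by simp
    qed
    then show ?thesis using i M[of i] e by (intro exI[of _ i]) (auto simp: K_def)
  qed
  then obtain C where C: "countable C" "C \<subseteq> K"
     "pairwise (\<lambda>i j. disjnt (cball (c i) (R i)) (cball (c j) (R j))) C"
     "negligible ((U \<inter> ?E) - (\<Union>i\<in>C. cball (c i) (R i)))"
    by (rule Vitali_covering_theorem_cballs[of K R "U \<inter> ?E" c, rotated]) (use R in auto)
  have bo: "(\<Union>i\<in>C. cball (c i) (R i)) \<in> sets borel" using C by auto
  have "negligible (U - (\<Union>i\<in>C. cball (c i) (R i)))"
    by (rule negligible_subset[OF negligible_Un[OF C(4) full]]) auto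
  then have 0: "emeasure lborel (U - (\<Union>i\<in>C. cball (c i) (R i))) = 0"
    using U bo by (auto simp: negligible_iff_null_sets null_sets_def)
  have "emeasure lborel U \<le> emeasure lborel ((\<Union>i\<in>C. cball (c i) (R i)) \<union> (U - (\<Union>i\<in>C. cball (c i) (R i))))"
    using U bo by (intro emeasure_mono) auto
  also have "\<dots> \<le> emeasure lborel (\<Union>i\<in>C. cball (c i) (R i)) + emeasure lborel (U - (\<Union>i\<in>C. cball (c i) (R i)))"
    using U bo by (intro emeasure_subadditive) auto
  also have "\<dots> = emeasure lborel (\<Union>i\<in>C. cball (c i) (R i))" by (simp add: 0)
  also have "\<dots> \<le> (\<integral>\<^sup>+i. emeasure lborel (cball (c i) (R i)) \<partial>count_space C)"
    using C by (intro emeasure_UN_le_nn_integral) auto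
  also have "\<dots> = (\<integral>\<^sup>+i. ennreal (unit_ball_vol (real DIM('a))) * ennreal (R i ^ DIM('a)) \<partial>count_space C)"
    by (rule nn_integral_cong) (auto simp: emeasure_cball_mult less_imp_le R)
  also have "\<dots> = ennreal (unit_ball_vol (real DIM('a))) * (\<integral>\<^sup>+i. ennreal (R i ^ DIM('a)) \<partial>count_space C)"
    by (rule nn_integral_cmult) auto
  finally show thesis using that C by (auto simp: K_def)
qed

text \<open>
  Bounded dilation of the radii does not affect whether the limsup has full measure. If the balls
  with index at least \<open>N\<close> missed a set of positive measure, then in a tight open superset \<open>V\<close> of that
  set the disjoint dilated balls would have to fill \<open>V\<close>, while the undilated ones fit into the small
  remainder.
\<close>
lemma limsup_full_if_dilates_full:
  fixes c :: "nat \<Rightarrow> 'a::euclidean_space"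
  assumes r: "\<And>i. r i > 0" "r \<longlonglongrightarrow> 0" and L: "L \<ge> 1"
    and le: "\<forall>\<^sub>F i in sequentially. R i \<le> L * r i"
    and full: "negligible (- limsup (\<lambda>i. cball (c i) (R i)))"
  shows "negligible (- limsup (\<lambda>i. cball (c i) (r i)))"
proof -
  have "limsup (\<lambda>i. cball (c i) (R i)) \<subseteq> limsup (\<lambda>i. cball (c i) (L * r i))"
    by (rule Limsup_mono) (use le in \<open>auto elim!: eventually_mono\<close>)
  then have full': "negligible (- limsup (\<lambda>i. cball (c i) (L * r i)))"
    by (intro negligible_subset[OF full]) auto
  define E where "E = (\<lambda>N. \<Union>i\<in>{N..}. cball (c i) (r i))"
  have "negligible (- E N)" for N
  proof (rule negligible_borelI)
    show bo: "- E N \<in> sets borel" unfolding E_def by auto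
    have "emeasure lborel (- E N) \<le> 0 + ennreal e" if "e > 0" for e
    proof -
      define e' where "e' = e / L ^ DIM('a)"
      have "e' > 0" using L that by (simp add: e'_def)
      obtain V where V: "open V" "- E N \<subseteq> V" "emeasure lborel (V - (- E N)) < ennreal e'"
        by (rule outer_regular_lborel[OF bo \<open>e' > 0\<close>])
      obtain C where C: "C \<subseteq> {i. N \<le> i \<and> cball (c i) (L * r i) \<subseteq> V}"
          "pairwise (\<lambda>i j. disjnt (cball (c i) (L * r i)) (cball (c j) (L * r j))) C"
          "emeasure lborel V \<le> ennreal (unit_ball_vol (real DIM('a))) *
              (\<integral>\<^sup>+i. ennreal ((L * r i) ^ DIM('a)) \<partial>count_space C)"
      proof (rule vitali_limsup_cballs[of "\<lambda>i. L * r i" c V N])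
        show "(\<lambda>i. L * r i) \<longlonglongrightarrow> 0" using tendsto_mult_left[OF r(2), of L] by simp
      qed (use L r full' V in auto)
      have sub: "cball (c i) (r i) \<subseteq> cball (c i) (L * r i)" for i
        using mult_right_mono[OF L, of "r i"] r(1)[of i]
        by (intro subset_cball) simp
      have "emeasure lborel (- E N) \<le> emeasure lborel V"
        using V by (intro emeasure_mono) auto
      also note C(3)
      also have "(\<integral>\<^sup>+i. ennreal ((L * r i) ^ DIM('a)) \<partial>count_space C)
          = (\<integral>\<^sup>+i. ennreal (L ^ DIM('a)) * ennreal (r i ^ DIM('a)) \<partial>count_space C)"
        using L by (intro nn_integral_cong) (simp add: power_mult_distrib ennreal_mult')
      also have "\<dots> = ennreal (L ^ DIM('a)) * (\<integral>\<^sup>+i. ennreal (r i ^ DIM('a)) \<partial>count_space C)"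
        by (rule nn_integral_cmult) auto
      also have "ennreal (unit_ball_vol (real DIM('a))) * \<dots> = ennreal (L ^ DIM('a)) *
          (ennreal (unit_ball_vol (real DIM('a))) * (\<integral>\<^sup>+i. ennreal (r i ^ DIM('a)) \<partial>count_space C))"
        by (simp add: ac_simps)
      also have "\<dots> \<le> ennreal (L ^ DIM('a)) * emeasure lborel (V - (- E N))"
      proof (intro mult_left_mono disjoint_cballs_hausdorff_sum)
        show "pairwise (\<lambda>i j. disjnt (cball (c i) (r i)) (cball (c j) (r j))) C"
          using C(2) sub unfolding pairwise_def disjnt_def by blast
        show "cball (c i) (r i) \<subseteq> V - (- E N)" if "i \<in> C" for i
          using C(1) that sub unfolding E_def by fastforce
        show "V - (- E N) \<in> sets borel" using V(1) by (intro sets.Diff[OF _ bo]) simp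
      qed (use r in auto)
      also have "\<dots> \<le> ennreal (L ^ DIM('a)) * ennreal e'"
        using V by (intro mult_left_mono) auto
      also have "\<dots> = ennreal e"
        using L that by (simp add: e'_def flip: ennreal_mult')
      finally show ?thesis by simp
    qed
    then have "emeasure lborel (- E N) \<le> 0"
      by (rule ennreal_le_epsilon)
    then show "emeasure lborel (- E N) = 0" by simp
  qed
  then have "negligible (\<Union>N. - E N)"
    by (intro negligible_countable_Union) auto
  moreover have "- limsup (\<lambda>i. cball (c i) (r i)) \<subseteq> (\<Union>N. - E N)"
    by (fastforce simp: mem_limsup_iff E_def)
  ultimately show ?thesis by (rule negligible_subset)
qed

lemma hausdorff_measure_Int_eq_if_negligible_Compl:
  fixes E :: "'a::euclidean_space set"
  assumes "negligible (- E)" "\<delta> > 0" "a > 0" "\<And>t. 0 < t \<Longrightarrow> t < \<delta> \<Longrightarrow> f t \<le> a * t ^ DIM('a)"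
  shows "hausdorff_measure f (B \<inter> E) = hausdorff_measure f B"
proof (rule antisym)
  have "hausdorff_measure f (B - E) \<le> ennreal a * hausdorff_measure (\<lambda>t. t ^ DIM('a)) (B - E)"
    using assms by (intro hausdorff_measure_le_mult) auto
  also have "hausdorff_measure (\<lambda>t. t ^ DIM('a)) (B - E) = 0"
    by (intro hausdorff_measure_negligible negligible_subset[OF assms(1)]) auto
  finally have 0: "hausdorff_measure f (B - E) = 0" by simp
  have "hausdorff_measure f B \<le> hausdorff_measure f ((B \<inter> E) \<union> (B - E))"
    by (rule hausdorff_measure_mono) auto
  also have "\<dots> \<le> hausdorff_measure f (B \<inter> E) + hausdorff_measure f (B - E)"
    by (rule hausdorff_measure_Un)
  finally show "hausdorff_measure f B \<le> hausdorff_measure f (B \<inter> E)" by (simp add: 0)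
qed (auto intro: hausdorff_measure_mono)

section \<open>Separated layers of balls\<close>

lemma vitali_limsup_cballs_finite:
  fixes c :: "nat \<Rightarrow> 'a::euclidean_space"
  assumes R: "\<And>i. R i > 0" "R \<longlonglongrightarrow> 0"
    and full: "negligible (- limsup (\<lambda>i. cball (c i) (R i)))"
    and U: "open U" and v: "0 \<le> u" "u < v"
    and le: "ennreal (unit_ball_vol (real DIM('a)) * v) \<le> emeasure lborel U"
  obtains S where "finite S" "S \<subseteq> {i. N \<le> i \<and> cball (c i) (R i) \<subseteq> U}"
    "pairwise (\<lambda>i j. disjnt (cball (c i) (R i)) (cball (c j) (R j))) S"
    "u \<le> (\<Sum>i\<in>S. R i ^ DIM('a))"
proof -
  let ?w = "unit_ball_vol (real DIM('a))"
  obtain C where C: "C \<subseteq> {i. N \<le> i \<and> cball (c i) (R i) \<subseteq> U}"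
    "pairwise (\<lambda>i j. disjnt (cball (c i) (R i)) (cball (c j) (R j))) C"
    "emeasure lborel U \<le> ennreal ?w * (\<integral>\<^sup>+i. ennreal (R i ^ DIM('a)) \<partial>count_space C)"
    by (rule vitali_limsup_cballs[OF R full U])
  have "ennreal ?w * ennreal v = ennreal (?w * v)"
    using v by (intro ennreal_mult[symmetric]) auto
  also note le
  also note C(3)
  finally have "ennreal v \<le> (\<integral>\<^sup>+i. ennreal (R i ^ DIM('a)) \<partial>count_space C)"
    by (rule ennreal_mult_le_cancel[rotated]) simp
  also have "\<dots> = infsum (\<lambda>i. ennreal (R i ^ DIM('a))) C"
    by (rule infsum_eq_nn_integral_count_space[symmetric])
  also have "\<dots> = (SUP F\<in>{F. finite F \<and> F \<subseteq> C}. \<Sum>i\<in>F. ennreal (R i ^ DIM('a)))"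
    by (rule nonneg_infsum_complete) simp
  finally have "ennreal v \<le> (SUP F\<in>{F. finite F \<and> F \<subseteq> C}. \<Sum>i\<in>F. ennreal (R i ^ DIM('a)))" .
  moreover have "ennreal u < ennreal v" using v by (intro ennreal_lessI) auto
  ultimately have "ennreal u < (SUP F\<in>{F. finite F \<and> F \<subseteq> C}. \<Sum>i\<in>F. ennreal (R i ^ DIM('a)))"
    by (rule less_le_trans[rotated])
  then obtain S where S: "finite S" "S \<subseteq> C" "ennreal u < (\<Sum>i\<in>S. ennreal (R i ^ DIM('a)))"
    by (auto simp: less_SUP_iff)
  have "u \<le> (\<Sum>i\<in>S. R i ^ DIM('a))"
    using S(3) R(1) v(1) by (subst (asm) sum_ennreal) (auto simp: less_imp_le ennreal_less_iff)
  moreover have "pairwise (\<lambda>i j. disjnt (cball (c i) (R i)) (cball (c j) (R j))) S"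
    using C(2) S(2) by (rule pairwise_subset)
  ultimately show thesis using that S C(1) by blast
qed

lemma sum_radius_power_le:
  fixes c :: "'i \<Rightarrow> 'a::euclidean_space"
  assumes S: "finite S" "pairwise (\<lambda>i j. disjnt (cball (c i) (R i)) (cball (c j) (R j))) S"
    and R: "\<And>i. i \<in> S \<Longrightarrow> 0 < R i" and sub: "\<And>i. i \<in> S \<Longrightarrow> cball (c i) (R i) \<subseteq> cball x r" and r: "r \<ge> 0"
  shows "(\<Sum>i\<in>S. R i ^ DIM('a)) \<le> r ^ DIM('a)"
proof -
  let ?w = "unit_ball_vol (real DIM('a))"
  have "ennreal ?w * (\<integral>\<^sup>+i. ennreal (R i ^ DIM('a)) \<partial>count_space S) \<le> emeasure lborel (cball x r)"
    by (rule disjoint_cballs_hausdorff_sum) (use assms in \<open>auto intro: countable_finite\<close>)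
  also have "\<dots> = ennreal ?w * ennreal (r ^ DIM('a))"
    using r by (rule emeasure_cball_mult)
  also have "(\<integral>\<^sup>+i. ennreal (R i ^ DIM('a)) \<partial>count_space S) = ennreal (\<Sum>i\<in>S. R i ^ DIM('a))"
    using S R by (simp add: nn_integral_count_space_finite sum_ennreal less_imp_le)
  finally have "ennreal (\<Sum>i\<in>S. R i ^ DIM('a)) \<le> ennreal (r ^ DIM('a))"
    by (rule ennreal_mult_le_cancel[rotated]) simp
  then show ?thesis using r by (simp add: ennreal_le_iff)
qed

text \<open>
  Layers \<open>S 0, \<dots>, S (T - 1)\<close> of indices. Within a layer, the large balls (radii \<open>R\<close>) are disjoint;
  the large balls of a later layer are no larger than any small ball (radius \<open>r\<close>) of an earlier
  layer, and disjoint from the threefold dilates of these small balls.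
\<close>
definition separated_layers ::
    "(nat \<Rightarrow> 'a::euclidean_space) \<Rightarrow> (nat \<Rightarrow> real) \<Rightarrow> (nat \<Rightarrow> real) \<Rightarrow> nat \<Rightarrow> (nat \<Rightarrow> nat set) \<Rightarrow> bool" where
  "separated_layers c r R T S \<longleftrightarrow>
     (\<forall>t<T. finite (S t) \<and> pairwise (\<lambda>i j. disjnt (cball (c i) (R i)) (cball (c j) (R j))) (S t)) \<and>
     (\<forall>t<T. \<forall>u<T. t < u \<longrightarrow> (\<forall>i\<in>S t. \<forall>j\<in>S u.
        R j \<le> r i \<and> disjnt (cball (c j) (R j)) (cball (c i) (3 * r i))))"

text \<open>
  Any prescribed number \<open>T\<close> of layers exists, each filling at least a quarter of a given ball. The
  dilated small balls that a new layer must avoid take up at most half of the volume, since \<open>r i\<close> is small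
  compared with \<open>R i\<close>, by an amount depending on \<open>T\<close>.
\<close>
lemma ex_separated_layers:
  fixes c :: "nat \<Rightarrow> 'a::euclidean_space"
  assumes r: "\<And>i. r i > 0" and R: "\<And>i. R i > 0" "R \<longlonglongrightarrow> 0"
    and full: "negligible (- limsup (\<lambda>i. cball (c i) (R i)))"
    and s: "s > 0"
    and small: "\<And>i. i \<ge> N \<Longrightarrow> 2 * real T * (3 * r i) ^ DIM('a) \<le> R i ^ DIM('a)"
  shows "\<exists>S. separated_layers c r R T S \<and>
           (\<forall>t<T. S t \<subseteq> {i. N \<le> i \<and> cball (c i) (R i) \<subseteq> cball x s} \<and>
                   s ^ DIM('a) / 4 \<le> (\<Sum>i\<in>S t. R i ^ DIM('a)))"
proof -
  let ?d = "DIM('a)"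
  let ?w = "unit_ball_vol (real DIM('a))"
  have "n \<le> T \<Longrightarrow> \<exists>S. separated_layers c r R n S \<and>
           (\<forall>t<n. S t \<subseteq> {i. N \<le> i \<and> cball (c i) (R i) \<subseteq> cball x s} \<and>
                   s ^ ?d / 4 \<le> (\<Sum>i\<in>S t. R i ^ ?d))" for n
  proof (induction n)
    case 0
    show ?case by (simp add: separated_layers_def)
  next
    case (Suc n)
    then obtain S where S: "separated_layers c r R n S"
      and S1: "\<And>t. t < n \<Longrightarrow> S t \<subseteq> {i. N \<le> i \<and> cball (c i) (R i) \<subseteq> cball x s}"
      and S2: "\<And>t. t < n \<Longrightarrow> s ^ ?d / 4 \<le> (\<Sum>i\<in>S t. R i ^ ?d)"
      by auto
    have fin: "finite (S t)" if "t < n" for t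
      using S that by (simp add: separated_layers_def)
    define G where "G = (\<Union>t<n. S t)"
    have finG: "finite G" using fin by (simp add: G_def)
    define U where "U = ball x s - (\<Union>i\<in>G. cball (c i) (3 * r i))"
    have bo: "(\<Union>i\<in>G. cball (c i) (3 * r i)) \<in> sets borel" using finG by auto
    have "open U" unfolding U_def using finG by (intro open_Diff closed_UN) auto
    \<comment> \<open>The earlier layers take away at most half of the volume of the ball.\<close>
    have removed: "(\<Sum>i\<in>G. (3 * r i) ^ ?d) \<le> s ^ ?d / 2"
    proof -
      have layer: "(\<Sum>i\<in>S t. (3 * r i) ^ ?d) \<le> s ^ ?d / (2 * real T)" if "t < n" for t
      proof -
        have T: "T > 0" using \<open>t < n\<close> Suc.prems by simp
        have "(\<Sum>i\<in>S t. (3 * r i) ^ ?d) \<le> (\<Sum>i\<in>S t. R i ^ ?d / (2 * real T))"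
          using S1[OF that] small T by (intro sum_mono) (auto simp: field_simps)
        also have "\<dots> = (\<Sum>i\<in>S t. R i ^ ?d) / (2 * real T)"
          by (rule sum_divide_distrib[symmetric])
        also have "\<dots> \<le> s ^ ?d / (2 * real T)"
        proof (intro divide_right_mono sum_radius_power_le)
          show "pairwise (\<lambda>i j. disjnt (cball (c i) (R i)) (cball (c j) (R j))) (S t)"
            using S that by (simp add: separated_layers_def)
        qed (use fin S1 that R s in auto)
        finally show ?thesis .
      qed
      have "(\<Sum>i\<in>G. (3 * r i) ^ ?d) \<le> (\<Sum>t<n. \<Sum>i\<in>S t. (3 * r i) ^ ?d)"
      proof -
        have "G = snd ` Sigma {..<n} S" by (force simp: G_def)
        moreover have "finite (Sigma {..<n} S)" using fin by auto
        ultimately have "(\<Sum>i\<in>G. (3 * r i) ^ ?d) \<le> (\<Sum>p\<in>Sigma {..<n} S. (3 * r (snd p)) ^ ?d)"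
          using r sum_image_le[of "Sigma {..<n} S" "\<lambda>i. (3 * r i) ^ ?d" snd]
          by (simp add: o_def less_imp_le)
        also have "\<dots> = (\<Sum>t<n. \<Sum>i\<in>S t. (3 * r i) ^ ?d)"
          using fin by (subst sum.Sigma) (auto simp: case_prod_beta)
        finally show ?thesis .
      qed
      also have "\<dots> \<le> (\<Sum>t<n. s ^ ?d / (2 * real T))"
        using layer by (intro sum_mono) auto
      also have "\<dots> = real n * (s ^ ?d / (2 * real T))" by simp
      also have "\<dots> \<le> real T * (s ^ ?d / (2 * real T))"
        using Suc.prems s by (intro mult_right_mono) auto
      also have "\<dots> = s ^ ?d / 2" using Suc.prems by simp
      finally show ?thesis .
    qed
    have "emeasure lborel (ball x s) \<le> emeasure lborel (U \<union> (\<Union>i\<in>G. cball (c i) (3 * r i)))"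
      using \<open>open U\<close> bo by (intro emeasure_mono) (auto simp: U_def)
    also have "\<dots> \<le> emeasure lborel U + emeasure lborel (\<Union>i\<in>G. cball (c i) (3 * r i))"
      using \<open>open U\<close> bo by (intro emeasure_subadditive) auto
    also have "emeasure lborel (\<Union>i\<in>G. cball (c i) (3 * r i)) \<le> (\<Sum>i\<in>G. emeasure lborel (cball (c i) (3 * r i)))"
      using finG by (intro emeasure_subadditive_finite) auto
    also have "\<dots> = (\<Sum>i\<in>G. ennreal (?w * (3 * r i) ^ ?d))"
      using r by (intro sum.cong) (auto simp: emeasure_cball less_imp_le)
    also have "\<dots> = ennreal (?w * (\<Sum>i\<in>G. (3 * r i) ^ ?d))"
      using r by (subst sum_ennreal) (auto simp: less_imp_le sum_distrib_left)
    also have "\<dots> \<le> ennreal (?w * (s ^ ?d / 2))"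
      using removed by (intro ennreal_leI mult_left_mono) auto
    finally have "ennreal (?w * s ^ ?d) \<le> emeasure lborel U + ennreal (?w * (s ^ ?d / 2))"
      using s by (simp add: emeasure_ball add_left_mono)
    also have "ennreal (?w * s ^ ?d) = ennreal (?w * (s ^ ?d / 2)) + ennreal (?w * (s ^ ?d / 2))"
      using s by (simp flip: ennreal_plus)
    finally have U_large: "ennreal (?w * (s ^ ?d / 2)) \<le> emeasure lborel U"
      by (simp add: add.commute[of "emeasure lborel U"] ennreal_add_left_cancel_le)
    have "\<forall>\<^sub>F i in sequentially. \<forall>j\<in>G. R i < r j"
      using finG r by (intro eventually_ball_finite) (auto intro: order_tendstoD(2)[OF R(2)])
    then obtain M where M: "\<And>i j. i \<ge> M \<Longrightarrow> j \<in> G \<Longrightarrow> R i < r j"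
      by (auto simp: eventually_sequentially)
    obtain L where L: "finite L" "L \<subseteq> {i. max M N \<le> i \<and> cball (c i) (R i) \<subseteq> U}"
        "pairwise (\<lambda>i j. disjnt (cball (c i) (R i)) (cball (c j) (R j))) L"
        "s ^ ?d / 4 \<le> (\<Sum>i\<in>L. R i ^ ?d)"
      by (rule vitali_limsup_cballs_finite[OF R full \<open>open U\<close> _ _ U_large, of "s ^ ?d / 4" "max M N"])
         (use s in auto)
    define S' where "S' = S(n := L)"
    have "separated_layers c r R (Suc n) S'"
      unfolding separated_layers_def
    proof (intro conjI allI impI ballI)
      fix t u i j assume *: "t < Suc n" "u < Suc n" "t < u" "i \<in> S' t" "j \<in> S' u"
      have "R j \<le> r i \<and> disjnt (cball (c j) (R j)) (cball (c i) (3 * r i))"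
      proof (cases "u = n")
        case True
        then have ij: "j \<in> L" "i \<in> G" using * by (auto simp: S'_def G_def split: if_splits)
        then have "cball (c j) (R j) \<subseteq> U" "j \<ge> M" using L(2) by auto
        then show ?thesis using ij M[of j i] by (auto simp: U_def disjnt_def)
      next
        case False
        then have "u < n" "t < n" "i \<in> S t" "j \<in> S u" using * by (auto simp: S'_def)
        then show ?thesis using S \<open>t < u\<close> unfolding separated_layers_def by blast
      qed
      then show "R j \<le> r i" "disjnt (cball (c j) (R j)) (cball (c i) (3 * r i))" by auto
    qed (use S L in \<open>auto simp: separated_layers_def S'_def less_Suc_eq\<close>)
    moreover have "S' t \<subseteq> {i. N \<le> i \<and> cball (c i) (R i) \<subseteq> cball x s} \<and>
        s ^ ?d / 4 \<le> (\<Sum>i\<in>S' t. R i ^ ?d)" if "t < Suc n" for t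
    proof (cases "t = n")
      case True
      have "U \<subseteq> cball x s" by (auto simp: U_def)
      then show ?thesis using True L by (auto simp: S'_def)
    next
      case False
      then show ?thesis using that S1[of t] S2[of t] by (simp add: S'_def)
    qed
    ultimately show ?case by blast
  qed
  then show ?thesis by blast
qed

lemma dist_gt_if_disjnt_cballs:
  fixes a b :: "'a::euclidean_space"
  assumes "disjnt (cball a R) (cball b Q)" "R \<ge> 0" "Q \<ge> 0"
  shows "dist a b > R + Q"
proof (rule ccontr)
  assume "\<not> ?thesis"
  then have le: "dist a b \<le> R + Q" by simp
  show False
  proof (cases "R + Q = 0")
    case True
    then have "R = 0" "Q = 0" using assms by auto
    then show ?thesis using le assms by (auto simp: disjnt_def)
  next
    case False
    then have pos: "R + Q > 0" using assms by simp
    define t where "t = R / (R + Q)"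
    define z where "z = a + t *\<^sub>R (b - a)"
    have t: "0 \<le> t" "t \<le> 1" "t * (R + Q) = R" "(1 - t) * (R + Q) = Q"
      using assms pos by (auto simp: t_def field_simps)
    have "dist a z = t * dist a b" using t by (simp add: z_def dist_norm norm_minus_commute)
    also have "\<dots> \<le> R" using mult_left_mono[OF le t(1)] t by simp
    finally have 1: "z \<in> cball a R" by simp
    have "b - z = (1 - t) *\<^sub>R (b - a)" by (simp add: z_def algebra_simps)
    then have "dist b z = (1 - t) * dist a b" using t by (simp add: dist_norm norm_minus_commute)
    also have "\<dots> \<le> Q" using mult_left_mono[OF le, of "1 - t"] t by simp
    finally have "z \<in> cball b Q" by simp
    with 1 show ?thesis using assms by (auto simp: disjnt_def)
  qed
qed

lemma sum_le_if_at_most_one: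
  fixes g :: "'i \<Rightarrow> real"
  assumes "\<And>p q. p \<in> A \<Longrightarrow> q \<in> A \<Longrightarrow> p = q" "\<And>p. p \<in> A \<Longrightarrow> g p \<le> b" "0 \<le> b"
  shows "sum g A \<le> b"
proof (cases "A = {}")
  case False
  then obtain p where "A = {p}" using assms(1) by blast
  then show ?thesis using assms(2) by simp
qed (use assms in simp)

text \<open>
  The charge carried by one covering ball \<open>D = cball y s\<close>, where \<open>b\<close> plays the role of \<open>f s\<close>. Among
  the small balls meeting \<open>D\<close>, three kinds are distinguished. Those with \<open>r i \<le> s\<close> and \<open>R i \<le> 4 s\<close>
  have their large ball inside \<open>cball y (9 s)\<close>, so each layer contributes at most \<open>(9 s)\<^sup>k\<close>.
  At most one, over all layers, has \<open>r i \<le> s\<close> and \<open>R i > 4 s\<close>, and at most one has \<open>r i > s\<close>: two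
  of them in one layer would have intersecting large balls, and two in different layers would
  violate the separation of scales or the threefold distance.
\<close>
lemma sum_layers_touching_cball_le:
  fixes c :: "nat \<Rightarrow> 'a::euclidean_space"
  assumes S: "separated_layers c r R T S"
    and r: "\<And>i. r i > 0" and R: "\<And>i. R i > 0" and rR: "\<And>t i. t < T \<Longrightarrow> i \<in> S t \<Longrightarrow> 2 * r i \<le> R i"
    and s: "s > 0" and T: "real T * s ^ DIM('a) \<le> 9 * b"
    and le: "\<And>i. r i \<le> s \<Longrightarrow> R i ^ DIM('a) \<le> b"
    and K: "K = 1 + 9 ^ (DIM('a) + 1)"
  shows "(\<Sum>(t, i)\<in>Sigma {..<T} S. if cball y s \<inter> cball (c i) (r i) = {} then 0
            else if r i \<le> s then R i ^ DIM('a) else K * b) \<le> 2 * K * b"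
proof -
  let ?d = "DIM('a)"
  define P where "P = {p \<in> Sigma {..<T} S. cball y s \<inter> cball (c (snd p)) (r (snd p)) \<noteq> {}}"
  define g where "g = (\<lambda>p::nat \<times> nat. if r (snd p) \<le> s then R (snd p) ^ ?d else K * b)"
  \<comment> \<open>\<open>A\<close>, \<open>B\<close> and \<open>C\<close> collect the three kinds of small balls.\<close>
  define A where "A = {p\<in>P. r (snd p) \<le> s \<and> R (snd p) \<le> 4 * s}"
  define B where "B = {p\<in>P. r (snd p) \<le> s \<and> 4 * s < R (snd p)}"
  define C where "C = {p\<in>P. s < r (snd p)}"
  have finS: "finite (Sigma {..<T} S)"
    using S by (auto simp: separated_layers_def)
  then have finP: "finite P" by (auto simp: P_def)
  have b: "b \<ge> 0"
  proof -
    have "0 \<le> real T * s ^ ?d" using s by simp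
    then show ?thesis using T by linarith
  qed
  have K1: "K \<ge> 1" by (simp add: K)
  have subR: "cball (c i) (r i) \<subseteq> cball (c i) (R i)" if "t < T" "i \<in> S t" for t i
    using rR[OF that] r[of i] by (intro subset_cball) simp
  have disj: "disjnt (cball (c i) (R i)) (cball (c j) (R j))" if "t < T" "i \<in> S t" "j \<in> S t" "i \<noteq> j" for t i j
    using S that by (auto simp: separated_layers_def pairwise_def)
  have later: "R j \<le> r i" "disjnt (cball (c j) (R j)) (cball (c i) (3 * r i))"
    if "t < T" "u < T" "t < u" "i \<in> S t" "j \<in> S u" for t u i j
    using S that unfolding separated_layers_def by blast+
  have touch: "\<exists>p. dist y p \<le> s \<and> dist (c i) p \<le> r i" if "(t, i) \<in> P" for t i
    using that by (auto simp: P_def)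
  have near: "dist (c i) (c j) \<le> r i + r j + 2 * s"
    if P: "(t, i) \<in> P" "(u, j) \<in> P" for t u i j
  proof -
    obtain p q where p: "dist y p \<le> s" "dist (c i) p \<le> r i" and q: "dist y q \<le> s" "dist (c j) q \<le> r j"
      using touch[OF P(1)] touch[OF P(2)] by blast
    have "dist (c i) (c j) \<le> dist (c i) p + dist y p + dist y q + dist (c j) q"
      by metric
    then show ?thesis using p q by linarith
  qed
  have A: "sum g A \<le> 9 ^ (?d + 1) * b"
  proof -
    define At where "At = (\<lambda>t. {i\<in>S t. cball y s \<inter> cball (c i) (r i) \<noteq> {} \<and> r i \<le> s \<and> R i \<le> 4 * s})"
    have layer: "(\<Sum>i\<in>At t. R i ^ ?d) \<le> (9 * s) ^ ?d" if "t < T" for t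
    proof (rule sum_radius_power_le)
      show "finite (At t)" using S that by (auto simp: At_def separated_layers_def)
      show "pairwise (\<lambda>i j. disjnt (cball (c i) (R i)) (cball (c j) (R j))) (At t)"
        using disj[OF that] by (auto simp: pairwise_def At_def)
      show "cball (c i) (R i) \<subseteq> cball y (9 * s)" if i: "i \<in> At t" for i
      proof
        fix z assume "z \<in> cball (c i) (R i)"
        obtain p where p: "dist y p \<le> s" "p \<in> cball (c i) (r i)" using i by (auto simp: At_def)
        then have "dist (c i) p \<le> R i" using subR[OF \<open>t < T\<close>, of i] i by (auto simp: At_def)
        moreover have "dist y z \<le> dist y p + dist (c i) p + dist (c i) z" by metric
        ultimately show "z \<in> cball y (9 * s)"
          using p \<open>z \<in> _\<close> i by (simp add: At_def)
      qed
    qed (use R s in auto)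
    have "sum g A = (\<Sum>(t, i)\<in>Sigma {..<T} At. R i ^ ?d)"
      by (rule sum.cong) (auto simp: A_def At_def P_def g_def)
    also have "\<dots> = (\<Sum>t<T. \<Sum>i\<in>At t. R i ^ ?d)"
      using S by (subst sum.Sigma) (auto simp: At_def separated_layers_def)
    also have "\<dots> \<le> (\<Sum>t<T. (9 * s) ^ ?d)"
      using layer by (intro sum_mono) auto
    also have "\<dots> = 9 ^ ?d * (real T * s ^ ?d)" by (simp add: power_mult_distrib)
    also have "\<dots> \<le> 9 ^ ?d * (9 * b)" using T by (intro mult_left_mono) auto
    finally show ?thesis by simp
  qed
  have B: "sum g B \<le> b"
  proof (rule sum_le_if_at_most_one)
    have "t = u \<and> i = j" if "t \<le> u" "(t, i) \<in> B" "(u, j) \<in> B" for t u i j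
    proof -
      have *: "t < T" "u < T" "i \<in> S t" "j \<in> S u" using that by (auto simp: B_def P_def)
      have "\<not> t < u"
      proof
        assume "t < u"
        from later(1)[OF *(1,2) this *(3,4)] show False using that s by (simp add: B_def)
      qed
      then have "t = u" using \<open>t \<le> u\<close> by linarith
      moreover have "i = j"
      proof (rule ccontr)
        assume "i \<noteq> j"
        then have "R i + R j < dist (c i) (c j)"
          using disj[OF *(1,3)] *(4) \<open>t = u\<close> R by (intro dist_gt_if_disjnt_cballs) (auto simp: less_imp_le)
        moreover have "dist (c i) (c j) \<le> r i + r j + 2 * s"
          using that by (intro near) (auto simp: B_def)
        ultimately show False using that s by (simp add: B_def)
      qed
      ultimately show ?thesis by simp
    qed
    then show "p = q" if "p \<in> B" "q \<in> B" for p q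
      using that by (metis nat_le_linear prod.collapse)
    show "g p \<le> b" if "p \<in> B" for p
      using that le by (auto simp: B_def g_def)
  qed (fact b)
  have C: "sum g C \<le> K * b"
  proof (rule sum_le_if_at_most_one)
    have "t = u \<and> i = j" if "t \<le> u" "(t, i) \<in> C" "(u, j) \<in> C" for t u i j
    proof -
      have *: "t < T" "u < T" "i \<in> S t" "j \<in> S u" using that by (auto simp: C_def P_def)
      have "\<not> t < u"
      proof
        assume "t < u"
        have "(t, i) \<in> P" "(u, j) \<in> P" using that by (auto simp: C_def)
        then obtain p q where p: "dist y p \<le> s" "dist (c i) p \<le> r i" and q: "dist y q \<le> s" "q \<in> cball (c j) (r j)"
          by (metis mem_cball touch)
        have "dist (c i) q \<le> dist (c i) p + dist y p + dist y q" by metric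
        then have "q \<in> cball (c i) (3 * r i)" using p q that by (simp add: C_def)
        moreover have "q \<in> cball (c j) (R j)" using q subR[OF *(2,4)] by auto
        ultimately show False using later(2)[OF *(1,2) \<open>t < u\<close> *(3,4)] by (auto simp: disjnt_def)
      qed
      then have "t = u" using \<open>t \<le> u\<close> by linarith
      moreover have "i = j"
      proof (rule ccontr)
        assume "i \<noteq> j"
        then have "R i + R j < dist (c i) (c j)"
          using disj[OF *(1,3)] *(4) \<open>t = u\<close> R by (intro dist_gt_if_disjnt_cballs) (auto simp: less_imp_le)
        moreover have "dist (c i) (c j) \<le> r i + r j + 2 * s"
          using that by (intro near) (auto simp: C_def)
        ultimately show False using that rR[OF *(1,3)] rR[OF *(2,4)] by (simp add: C_def)
      qed
      ultimately show ?thesis by simp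
    qed
    then show "p = q" if "p \<in> C" "q \<in> C" for p q
      using that by (metis nat_le_linear prod.collapse)
    show "g p \<le> K * b" if "p \<in> C" for p
      using that by (auto simp: C_def g_def)
  qed (use b K1 in simp)
  have "(\<Sum>(t, i)\<in>Sigma {..<T} S. if cball y s \<inter> cball (c i) (r i) = {} then 0
            else if r i \<le> s then R i ^ ?d else K * b) = sum g P"
    unfolding P_def sum.inter_filter[OF finS] by (rule sum.cong) (simp_all add: g_def case_prod_beta)
  also have "P = A \<union> B \<union> C" by (auto simp: A_def B_def C_def)
  also have "sum g (A \<union> B \<union> C) = sum g A + sum g B + sum g C"
    using finP by (subst sum.union_disjoint sum.union_disjoint, auto simp: A_def B_def C_def)+
  also have "\<dots> \<le> 9 ^ (?d + 1) * b + b + K * b" using A B C by linarith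
  also have "\<dots> = 2 * K * b" by (simp add: K algebra_simps)
  finally show ?thesis .
qed

section \<open>The descent through undercovered balls\<close>

text \<open>
  The cost of those balls \<open>cball (y j) (s j)\<close>, \<open>j \<in> I\<close>, of a cover that meet \<open>A\<close>.
\<close>
definition touching_cost ::
    "(real \<Rightarrow> real) \<Rightarrow> nat set \<Rightarrow> (nat \<Rightarrow> 'a::metric_space) \<Rightarrow> (nat \<Rightarrow> real) \<Rightarrow> 'a set \<Rightarrow> ennreal" where
  "touching_cost f I y s A =
     (\<integral>\<^sup>+j. ennreal (f (s j)) * indicator {j. cball (y j) (s j) \<inter> A \<noteq> {}} j \<partial>count_space I)"

lemma touching_cost_le: "touching_cost f I y s A \<le> (\<integral>\<^sup>+j. ennreal (f (s j)) \<partial>count_space I)"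
  unfolding touching_cost_def by (intro nn_integral_mono) (auto split: split_indicator)

lemma touching_cost_ge:
  assumes "j \<in> I" "cball (y j) (s j) \<inter> A \<noteq> {}"
  shows "ennreal (f (s j)) \<le> touching_cost f I y s A"
  using nn_integral_ge_point[OF assms(1),
      of "\<lambda>j. ennreal (f (s j)) * indicator {j. cball (y j) (s j) \<inter> A \<noteq> {}} j"] assms(2)
  by (simp add: touching_cost_def)

text \<open>
  The weight \<open>V\<close> equals \<open>f q\<close> when the ball \<open>cball x q\<close> is itself a member of the sequence, and is
  an arbitrary large constant for the ball in which the descent starts. The last hypothesis, which
  says that the covering balls have density \<open>f (s j) / s j ^ k\<close> at least \<open>V / q ^ k\<close>, makes up for
  the loss caused by the number of layers being proportional to \<open>V / q ^ k\<close>.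
\<close>
lemma ex_undercovered_subball:
  fixes c :: "nat \<Rightarrow> 'a::euclidean_space"
  assumes r: "\<And>i. r i > 0" and R: "\<And>i. R i > 0" "R \<longlonglongrightarrow> 0"
    and full: "negligible (- limsup (\<lambda>i. cball (c i) (R i)))"
    and fR: "\<And>i. R i ^ DIM('a) = f (r i)"
    and large: "\<And>L. \<forall>\<^sub>F i in sequentially. L * r i ^ DIM('a) \<le> R i ^ DIM('a)"
    and f: "mono_on {0<..} f" "\<forall>t>0. f t > 0"
    and K: "K = 1 + 9 ^ (DIM('a) + 1)"
    and q: "q > 0" and V: "q ^ DIM('a) \<le> V"
    and s: "\<And>j. j \<in> I \<Longrightarrow> s j > 0"
    and cost: "ennreal K * touching_cost f I y s (cball x q) < ennreal V"
    and dens: "\<And>j. j \<in> I \<Longrightarrow> cball (y j) (s j) \<inter> cball x q \<noteq> {} \<Longrightarrow> V * s j ^ DIM('a) \<le> f (s j) * q ^ DIM('a)"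
  shows "\<exists>i\<ge>N. cball (c i) (r i) \<subseteq> cball x q \<and>
           ennreal K * touching_cost f I y s (cball (c i) (r i)) < ennreal (f (r i))"
proof (rule ccontr)
  let ?d = "DIM('a)"
  assume "\<not> ?thesis"
  then have bad: "ennreal (f (r i)) \<le> ennreal K * touching_cost f I y s (cball (c i) (r i))"
    if "i \<ge> N" "cball (c i) (r i) \<subseteq> cball x q" for i
    using that by (meson not_le)
  have K1: "K \<ge> 1" by (simp add: K)
  have qd: "q ^ ?d > 0" using q by simp
  define T where "T = nat \<lceil>8 * V / q ^ ?d\<rceil>"
  have T8: "8 * V / q ^ ?d \<le> real T" unfolding T_def by linarith
  have "1 \<le> V / q ^ ?d" using V qd by simp
  then have T9: "real T \<le> 9 * V / q ^ ?d" unfolding T_def by linarith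
  obtain M where M: "\<And>i. i \<ge> M \<Longrightarrow> (2 * real T * 3 ^ ?d) * r i ^ ?d \<le> R i ^ ?d"
      "\<And>i. i \<ge> M \<Longrightarrow> 2 ^ ?d * r i ^ ?d \<le> R i ^ ?d"
    using eventually_conj[OF large[of "2 * real T * 3 ^ ?d"] large[of "2 ^ ?d"]]
    by (auto simp: eventually_sequentially)
  obtain S where S: "separated_layers c r R T S"
    and S1: "\<And>t. t < T \<Longrightarrow> S t \<subseteq> {i. max M N \<le> i \<and> cball (c i) (R i) \<subseteq> cball x q}"
    and S2: "\<And>t. t < T \<Longrightarrow> q ^ ?d / 4 \<le> (\<Sum>i\<in>S t. R i ^ ?d)"
  proof -
    have "2 * real T * (3 * r i) ^ ?d \<le> R i ^ ?d" if "i \<ge> max M N" for i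
      using M(1)[of i] that by (simp add: power_mult_distrib mult.assoc)
    then show thesis
      using ex_separated_layers[where r = r and T = T and N = "max M N" and x = x, OF r R full q] that
      by blast
  qed
  have rR: "2 * r i \<le> R i" if "t < T" "i \<in> S t" for t i
  proof -
    have "(2 * r i) ^ ?d \<le> R i ^ ?d"
      using M(2)[of i] S1[OF that(1)] that(2) by (auto simp: power_mult_distrib)
    then show ?thesis using r[of i] R(1)[of i] by (subst (asm) power_mono_iff) auto
  qed
  define P where "P = Sigma {..<T} S"
  have finP: "finite P" using S by (auto simp: P_def separated_layers_def)
  \<comment> \<open>The charge of the chosen ball \<open>p\<close> to the covering ball \<open>j\<close>: a covering ball at least as large
     as the chosen one pays its full value, a smaller one pays in proportion to its own cost.\<close>
  define h where "h = (\<lambda>(p :: nat \<times> nat) j. if cball (y j) (s j) \<inter> cball (c (snd p)) (r (snd p)) = {} then 0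
            else if r (snd p) \<le> s j then R (snd p) ^ ?d else K * f (s j))"
  have in_A: "snd p \<ge> N" "cball (c (snd p)) (r (snd p)) \<subseteq> cball x q" if in_P: "p \<in> P" for p
  proof -
    obtain t i where p: "p = (t, i)" "t < T" "i \<in> S t" using in_P by (auto simp: P_def)
    then have "cball (c i) (r i) \<subseteq> cball (c i) (R i)"
      using rR[of t i] r[of i] by (intro subset_cball) simp
    then show "snd p \<ge> N" "cball (c (snd p)) (r (snd p)) \<subseteq> cball x q"
      using S1[OF p(2)] p by auto
  qed
  have each: "ennreal (R (snd p) ^ ?d) \<le> (\<integral>\<^sup>+j. ennreal (h p j) \<partial>count_space I)" if "p \<in> P" for p
  proof (cases "\<exists>j\<in>I. cball (y j) (s j) \<inter> cball (c (snd p)) (r (snd p)) \<noteq> {} \<and> r (snd p) \<le> s j")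
    case True
    then obtain j where j: "j \<in> I" "cball (y j) (s j) \<inter> cball (c (snd p)) (r (snd p)) \<noteq> {}" "r (snd p) \<le> s j"
      by blast
    then have "ennreal (R (snd p) ^ ?d) = ennreal (h p j)" by (simp add: h_def)
    also have "\<dots> \<le> (\<integral>\<^sup>+j. ennreal (h p j) \<partial>count_space I)"
      using j(1) by (rule nn_integral_ge_point)
    finally show ?thesis .
  next
    case False
    have "ennreal (R (snd p) ^ ?d) = ennreal (f (r (snd p)))" by (simp add: fR)
    also have "\<dots> \<le> ennreal K * touching_cost f I y s (cball (c (snd p)) (r (snd p)))"
      by (rule bad[OF in_A[OF that]])
    also have "\<dots> = (\<integral>\<^sup>+j. ennreal K * (ennreal (f (s j)) * indicator {j. cball (y j) (s j) \<inter> cball (c (snd p)) (r (snd p)) \<noteq> {}} j) \<partial>count_space I)"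
      unfolding touching_cost_def by (rule nn_integral_cmult[symmetric]) simp
    also have "\<dots> \<le> (\<integral>\<^sup>+j. ennreal (h p j) \<partial>count_space I)"
    proof (rule nn_integral_mono)
      fix j assume "j \<in> space (count_space I)"
      then show "ennreal K * (ennreal (f (s j)) * indicator {j. cball (y j) (s j) \<inter> cball (c (snd p)) (r (snd p)) \<noteq> {}} j) \<le> ennreal (h p j)"
        using False K1 by (auto simp: h_def ennreal_mult')
    qed
    finally show ?thesis .
  qed
  have h_nonneg: "h p j \<ge> 0" if "j \<in> I" for p j
    using R(1)[of "snd p"] f(2)[rule_format, OF s[OF that]] K1 by (simp add: h_def)
  have per_set: "(\<Sum>p\<in>P. h p j) \<le> 2 * K * f (s j)"
    if j: "j \<in> I" "cball (y j) (s j) \<inter> cball x q \<noteq> {}" for j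
  proof -
    have "(\<Sum>p\<in>P. h p j) = (\<Sum>(t, i)\<in>Sigma {..<T} S. if cball (y j) (s j) \<inter> cball (c i) (r i) = {} then 0
            else if r i \<le> s j then R i ^ ?d else K * f (s j))"
      unfolding P_def by (rule sum.cong) (simp_all add: h_def case_prod_beta)
    also have "\<dots> \<le> 2 * K * f (s j)"
    proof (rule sum_layers_touching_cball_le[OF S r R(1) rR s[OF j(1)] _ _ K])
      have "real T * s j ^ ?d \<le> 9 * V / q ^ ?d * s j ^ ?d"
        using T9 s[OF j(1)] by (intro mult_right_mono) auto
      also have "\<dots> = 9 * (V * s j ^ ?d) / q ^ ?d" by simp
      also have "\<dots> \<le> 9 * (f (s j) * q ^ ?d) / q ^ ?d"
        using dens[OF j] qd by (intro divide_right_mono mult_left_mono) auto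
      also have "\<dots> = 9 * f (s j)" using q by simp
      finally show "real T * s j ^ ?d \<le> 9 * f (s j)" .
      show "R i ^ ?d \<le> f (s j)" if "r i \<le> s j" for i
        using f(1) that r[of i] s[OF j(1)] unfolding fR by (auto simp: mono_on_def)
    qed
    finally show ?thesis .
  qed
  have per_set': "(\<Sum>p\<in>P. ennreal (h p j))
      \<le> ennreal (2 * K) * (ennreal (f (s j)) * indicator {j. cball (y j) (s j) \<inter> cball x q \<noteq> {}} j)"
    if "j \<in> I" for j
  proof (cases "cball (y j) (s j) \<inter> cball x q = {}")
    case True
    then have "h p j = 0" if "p \<in> P" for p using in_A(2)[OF that] by (auto simp: h_def)
    then show ?thesis by simp
  next
    case False
    have "(\<Sum>p\<in>P. ennreal (h p j)) = ennreal (\<Sum>p\<in>P. h p j)"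
      using h_nonneg that by (intro sum_ennreal)
    also have "\<dots> \<le> ennreal (2 * K * f (s j))" using per_set[OF that False] by (rule ennreal_leI)
    also have "\<dots> = ennreal (2 * K) * ennreal (f (s j))" using K1 by (intro ennreal_mult') simp
    finally show ?thesis using False by simp
  qed
  \<comment> \<open>Double counting of the total charge.\<close>
  have "2 * V \<le> real T * (q ^ ?d / 4)" using T8 qd by (simp add: field_simps)
  also have "\<dots> = (\<Sum>t<T. q ^ ?d / 4)" by simp
  also have "\<dots> \<le> (\<Sum>t<T. \<Sum>i\<in>S t. R i ^ ?d)" using S2 by (intro sum_mono) auto
  also have "\<dots> = (\<Sum>p\<in>P. R (snd p) ^ ?d)"
    unfolding P_def using S by (subst sum.Sigma) (auto simp: separated_layers_def case_prod_beta)
  finally have "ennreal (2 * V) \<le> ennreal (\<Sum>p\<in>P. R (snd p) ^ ?d)" by (rule ennreal_leI)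
  also have "\<dots> = (\<Sum>p\<in>P. ennreal (R (snd p) ^ ?d))"
    using R(1) by (intro sum_ennreal[symmetric]) (simp add: less_imp_le)
  also have "\<dots> \<le> (\<Sum>p\<in>P. \<integral>\<^sup>+j. ennreal (h p j) \<partial>count_space I)"
    using each by (rule sum_mono)
  also have "\<dots> = (\<integral>\<^sup>+j. (\<Sum>p\<in>P. ennreal (h p j)) \<partial>count_space I)"
    by (rule nn_integral_sum[symmetric]) simp
  also have "\<dots> \<le> (\<integral>\<^sup>+j. ennreal (2 * K) * (ennreal (f (s j)) * indicator {j. cball (y j) (s j) \<inter> cball x q \<noteq> {}} j) \<partial>count_space I)"
    using per_set' by (intro nn_integral_mono) simp
  also have "\<dots> = ennreal (2 * K) * touching_cost f I y s (cball x q)"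
    unfolding touching_cost_def by (rule nn_integral_cmult) simp
  also have "\<dots> = ennreal 2 * (ennreal K * touching_cost f I y s (cball x q))"
    using K1 by (simp only: ennreal_mult' mult.assoc)
  also have "ennreal (2 * V) = ennreal 2 * ennreal V" by (rule ennreal_mult') simp
  finally have "ennreal V \<le> ennreal K * touching_cost f I y s (cball x q)"
    by (rule ennreal_mult_le_cancel[rotated]) simp
  with cost show False by (simp add: not_le[symmetric])
qed

lemma hausdorff_measure_limsup_eq_top:
  fixes c :: "nat \<Rightarrow> 'a::euclidean_space"
  assumes r: "\<And>i. r i > 0" "r \<longlonglongrightarrow> 0"
    and R: "\<And>i. R i > 0" and fR: "\<And>i. R i ^ DIM('a) = f (r i)"
    and full: "negligible (- limsup (\<lambda>i. cball (c i) (R i)))"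
    and f: "mono_on {0<..} f" "\<And>t. t > 0 \<Longrightarrow> f t > 0" "(f \<longlongrightarrow> 0) (at_right 0)"
    and anti: "antimono_on {0<..} (\<lambda>t. f t / t ^ DIM('a))"
    and unbounded: "\<And>L. \<exists>t>0. f t / t ^ DIM('a) \<ge> L"
    and q: "q > 0"
  shows "hausdorff_measure f (cball x q \<inter> limsup (\<lambda>i. cball (c i) (r i))) = top"
proof (rule ccontr)
  let ?d = "DIM('a)"
  let ?E = "limsup (\<lambda>i. cball (c i) (r i))"
  define K :: real where "K = 1 + 9 ^ (?d + 1)"
  have K1: "K \<ge> 1" by (simp add: K_def)
  assume "hausdorff_measure f (cball x q \<inter> ?E) \<noteq> top"
  then obtain m where m: "m \<ge> 0" "hausdorff_measure f (cball x q \<inter> ?E) = ennreal m"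
    by (cases "hausdorff_measure f (cball x q \<inter> ?E)") auto
  have blowup: "\<exists>\<delta>>0. \<forall>t. 0 < t \<longrightarrow> t \<le> \<delta> \<longrightarrow> L * t ^ ?d \<le> f t" for L
  proof -
    obtain \<delta> where \<delta>: "\<delta> > 0" "L \<le> f \<delta> / \<delta> ^ ?d" using unbounded by blast
    have "L * t ^ ?d \<le> f t" if "0 < t" "t \<le> \<delta>" for t
    proof -
      have "f \<delta> / \<delta> ^ ?d \<le> f t / t ^ ?d"
        using anti that \<delta> by (auto simp: monotone_on_def)
      then have "L \<le> f t / t ^ ?d" using \<delta> by linarith
      then show ?thesis using that by (simp add: pos_le_divide_eq)
    qed
    then show ?thesis using \<delta> by blast
  qed
  have large: "\<forall>\<^sub>F i in sequentially. L * r i ^ ?d \<le> R i ^ ?d" for L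
  proof -
    obtain \<delta> where \<delta>: "\<delta> > 0" "\<forall>t. 0 < t \<longrightarrow> t \<le> \<delta> \<longrightarrow> L * t ^ ?d \<le> f t" using blowup by blast
    have "\<forall>\<^sub>F i in sequentially. r i < \<delta>" using r(2) \<delta>(1) by (rule order_tendstoD)
    then show ?thesis by eventually_elim (use \<delta> r fR in \<open>auto simp: less_imp_le\<close>)
  qed
  have fr0: "(\<lambda>i. f (r i)) \<longlonglongrightarrow> 0"
  proof (rule filterlim_compose[OF f(3)])
    have "r i \<noteq> 0" for i using r(1)[of i] by simp
    then show "filterlim r (at_right 0) sequentially" using r by (simp add: filterlim_at)
  qed
  have R0: "R \<longlonglongrightarrow> 0"
  proof -
    have "(\<lambda>i. root ?d (R i ^ ?d)) \<longlonglongrightarrow> root ?d 0"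
      unfolding fR using fr0 by (rule tendsto_real_root)
    then show ?thesis using R by (simp add: real_root_power_cancel less_imp_le)
  qed
  \<comment> \<open>\<open>V\<close> exceeds \<open>K\<close> times the cost of the cover, and \<open>\<delta>\<close> is chosen so that balls of radius at most
     \<open>\<delta>\<close> have density at least \<open>V / q ^ k\<close>.\<close>
  define V where "V = q ^ ?d + K * (m + 1)"
  obtain \<delta> where \<delta>: "\<delta> > 0" "\<forall>t. 0 < t \<longrightarrow> t \<le> \<delta> \<longrightarrow> (V / q ^ ?d) * t ^ ?d \<le> f t"
    using blowup by blast
  have pre_le: "hausdorff_premeasure f \<delta> (cball x q \<inter> ?E) \<le> ennreal m"
    unfolding m(2)[symmetric] using \<delta>(1) by (rule hausdorff_premeasure_le_measure)
  then have pre_fin: "hausdorff_premeasure f \<delta> (cball x q \<inter> ?E) < top"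
    by (rule le_less_trans) simp
  obtain I :: "nat set" and y :: "nat \<Rightarrow> 'a" and s where
    I: "\<forall>j\<in>I. 0 < s j \<and> s j \<le> \<delta>" "cball x q \<inter> ?E \<subseteq> (\<Union>j\<in>I. cball (y j) (s j))"
      "(\<integral>\<^sup>+j. ennreal (f (s j)) \<partial>count_space I) < hausdorff_premeasure f \<delta> (cball x q \<inter> ?E) + ennreal 1"
    by (rule hausdorff_premeasure_coverE[OF pre_fin zero_less_one]) (rule that)
  define good where "good = (\<lambda>i. ennreal K * touching_cost f I y s (cball (c i) (r i)) < ennreal (f (r i)))"
  obtain N0 where N0: "\<And>i. i \<ge> N0 \<Longrightarrow> r i ^ ?d \<le> R i ^ ?d"
    using large[of 1] by (auto simp: eventually_sequentially)
  have f_pos: "\<forall>t>0. f t > 0" using f(2) by blast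
  note step = ex_undercovered_subball[OF r(1) R R0 full fR large f(1) f_pos K_def]
  have first: "\<exists>i\<ge>N. cball (c i) (r i) \<subseteq> cball x q \<and> good i" for N
    unfolding good_def
  proof (rule step[OF q])
    show "q ^ ?d \<le> V" using K1 m by (simp add: V_def)
    have "ennreal K * touching_cost f I y s (cball x q) \<le> ennreal K * (\<integral>\<^sup>+j. ennreal (f (s j)) \<partial>count_space I)"
      by (intro mult_left_mono touching_cost_le) simp
    also have "\<dots> \<le> ennreal K * (ennreal m + ennreal 1)"
      using I(3) pre_le by (intro mult_left_mono order_trans[OF less_imp_le[OF I(3)]] add_right_mono) auto
    also have "\<dots> = ennreal (K * (m + 1))"
      using K1 m by (simp add: ennreal_mult' ennreal_plus)
    also have "\<dots> < ennreal V" using q K1 m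
      by (intro ennreal_lessI) (auto simp: V_def intro!: add_pos_nonneg)
    finally show "ennreal K * touching_cost f I y s (cball x q) < ennreal V" .
    show "V * s j ^ ?d \<le> f (s j) * q ^ ?d" if "j \<in> I" for j
      using \<delta>(2) I(1) that q by (auto simp: field_simps)
  qed (use I in auto)
  have small_cover: "f (s j) < f (r i)" if "good i" "j \<in> I" "cball (y j) (s j) \<inter> cball (c i) (r i) \<noteq> {}" for i j
  proof -
    have "ennreal (f (s j)) \<le> ennreal K * ennreal (f (s j))"
      using K1 mult_right_mono[of 1 "ennreal K" "ennreal (f (s j))"] by simp
    also have "\<dots> \<le> ennreal K * touching_cost f I y s (cball (c i) (r i))"
      using that by (intro mult_left_mono touching_cost_ge) auto
    also have "\<dots> < ennreal (f (r i))" using that by (simp add: good_def)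
    finally show ?thesis using f(2) I(1) that by (auto simp: ennreal_less_iff less_imp_le)
  qed
  have descend: "\<exists>i'\<ge>N. cball (c i') (r i') \<subseteq> cball (c i) (r i) \<and> good i'" if "good i" "i \<ge> N0" for i N
    unfolding good_def
  proof (rule step[OF r(1)])
    show "r i ^ ?d \<le> f (r i)" using N0[OF that(2)] fR by simp
    show "ennreal K * touching_cost f I y s (cball (c i) (r i)) < ennreal (f (r i))"
      using that by (simp add: good_def)
    show "f (r i) * s j ^ ?d \<le> f (s j) * r i ^ ?d"
      if j: "j \<in> I" "cball (y j) (s j) \<inter> cball (c i) (r i) \<noteq> {}" for j
    proof -
      have "s j > 0" using I(1) j(1) by blast
      have "f (s j) < f (r i)" by (rule small_cover[OF \<open>good i\<close> j])
      \<comment> \<open>A covering ball meeting an undercovered ball is smaller, hence denser.\<close>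
      then have "s j < r i"
        using f(1) \<open>s j > 0\<close> r(1)[of i] by (meson greaterThan_iff leD leI monotone_onD)
      then have "f (r i) / r i ^ ?d \<le> f (s j) / s j ^ ?d"
        using anti \<open>s j > 0\<close> r(1)[of i] by (auto simp: monotone_on_def)
      then show ?thesis using \<open>s j > 0\<close> r(1)[of i] by (simp add: field_simps)
    qed
  qed (use I in auto)
  have "\<exists>i. \<forall>n. (good (i n) \<and> N0 \<le> i n \<and> n \<le> i n \<and> cball (c (i n)) (r (i n)) \<subseteq> cball x q) \<and>
           cball (c (i (Suc n))) (r (i (Suc n))) \<subseteq> cball (c (i n)) (r (i n))"
  proof (rule dependent_nat_choice)
    show "\<exists>i. good i \<and> N0 \<le> i \<and> 0 \<le> i \<and> cball (c i) (r i) \<subseteq> cball x q"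
      using first[of N0] by auto
    fix i n assume i: "good i \<and> N0 \<le> i \<and> n \<le> i \<and> cball (c i) (r i) \<subseteq> cball x q"
    then obtain i' where "i' \<ge> max N0 (Suc n)" "cball (c i') (r i') \<subseteq> cball (c i) (r i)" "good i'"
      using descend[of i "max N0 (Suc n)"] by blast
    then show "\<exists>i'. (good i' \<and> N0 \<le> i' \<and> Suc n \<le> i' \<and> cball (c i') (r i') \<subseteq> cball x q) \<and>
        cball (c i') (r i') \<subseteq> cball (c i) (r i)"
      using i by (intro exI[of _ i']) auto
  qed
  then obtain i where i: "\<And>n. good (i n)" "\<And>n. n \<le> i n" "\<And>n. cball (c (i n)) (r (i n)) \<subseteq> cball x q"
      "\<And>n. cball (c (i (Suc n))) (r (i (Suc n))) \<subseteq> cball (c (i n)) (r (i n))"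
    by blast
  have r_nonneg: "\<not> r k < 0" for k using r(1)[of k] by simp
  have "(\<Inter>n. cball (c (i n)) (r (i n))) \<noteq> {}"
  proof (rule compact_nest)
    show "cball (c (i n)) (r (i n)) \<subseteq> cball (c (i m)) (r (i m))" if "m \<le> n" for m n
      using that i(4) by (rule lift_Suc_antimono_le[rotated])
  qed (simp_all add: r_nonneg)
  then obtain p where p: "\<And>n. p \<in> cball (c (i n)) (r (i n))" by blast
  have "p \<in> cball x q" using p i(3) by blast
  moreover have "p \<in> ?E" unfolding mem_limsup_iff using p i(2) by blast
  ultimately obtain j where j: "j \<in> I" "p \<in> cball (y j) (s j)" using I(2) by blast
  have "\<forall>\<^sub>F k in sequentially. f (r k) < f (s j)"
    using fr0 f(2) I(1) j(1) by (intro order_tendstoD(2)) auto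
  then obtain n where "\<And>k. k \<ge> n \<Longrightarrow> f (r k) < f (s j)"
    by (auto simp: eventually_sequentially)
  then have "f (r (i n)) < f (s j)" using i(2) by blast
  moreover have "f (s j) < f (r (i n))"
    by (rule small_cover[OF i(1) j(1)]) (use p j in blast)
  ultimately show False by simp
qed

section \<open>The mass transference principle\<close>

text \<open>
  The mass transference principle in a Euclidean space, with the hypothesis in terms of Lebesgue
  null sets.
\<close>
theorem mass_transference:
  fixes c :: "nat \<Rightarrow> 'a::euclidean_space"
  assumes r: "\<And>i. r i > 0" "r \<longlonglongrightarrow> 0"
    and f: "dimension_function f"
    and mon: "mono_on {0<..} (\<lambda>t. f t / t ^ DIM('a)) \<or> antimono_on {0<..} (\<lambda>t. f t / t ^ DIM('a))"
    and R: "\<And>i. R i > 0" and fR: "\<And>i. R i ^ DIM('a) = f (r i)"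
    and full: "negligible (- limsup (\<lambda>i. cball (c i) (R i)))"
    and q: "q > 0"
  shows "hausdorff_measure f (cball x q \<inter> limsup (\<lambda>i. cball (c i) (r i))) = hausdorff_measure f (cball x q)"
proof -
  let ?d = "DIM('a)"
  let ?\<phi> = "\<lambda>t. f t / t ^ ?d"
  have f': "mono_on {0<..} f" "\<And>t. t > 0 \<Longrightarrow> f t > 0" "(f \<longlongrightarrow> 0) (at_right 0)"
    using f by (auto simp: dimension_function_def)
  show ?thesis
  proof (cases "antimono_on {0<..} ?\<phi> \<and> (\<forall>L. \<exists>t>0. ?\<phi> t \<ge> L)")
    case True
    then have "hausdorff_measure f (cball x q \<inter> limsup (\<lambda>i. cball (c i) (r i))) = top"
      by (intro hausdorff_measure_limsup_eq_top[OF r R fR full f']) (use q in auto)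
    moreover have "hausdorff_measure f (cball x q \<inter> limsup (\<lambda>i. cball (c i) (r i)))
        \<le> hausdorff_measure f (cball x q)"
      by (rule hausdorff_measure_mono) auto
    ultimately show ?thesis by (simp add: top_unique)
  next
    case False
    have "\<exists>a>0. \<forall>t. 0 < t \<longrightarrow> t < 1 \<longrightarrow> ?\<phi> t \<le> a"
    proof (cases "antimono_on {0<..} ?\<phi>")
      case True
      with False obtain a where "\<And>t. t > 0 \<Longrightarrow> ?\<phi> t < a" by (meson not_le)
      moreover from this[of 1] f'(2)[of 1] have "a > 0" by simp
      ultimately show ?thesis by (intro exI[of _ a]) (auto simp: less_imp_le)
    next
      case False
      then have mono: "mono_on {0<..} ?\<phi>" using mon by blast
      have "?\<phi> t \<le> f 1" if "0 < t" "t < 1" for t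
        using monotone_onD[OF mono, of t 1] that by simp
      then show ?thesis using f'(2)[of 1] by (intro exI[of _ "f 1"]) auto
    qed
    then obtain a where a: "a > 0" "\<And>t. 0 < t \<Longrightarrow> t < 1 \<Longrightarrow> f t \<le> a * t ^ ?d"
      by (auto simp: pos_divide_le_eq)
    \<comment> \<open>Only this upper bound on \<open>f\<close> is used: it gives both \<open>R i \<le> L * r i\<close> and that null sets are
       null for the Hausdorff measure.\<close>
    define L where "L = max 1 a"
    have L: "L \<ge> 1" "a \<le> L ^ ?d"
      using self_le_power[of L ?d] by (auto simp: L_def)
    have "\<forall>\<^sub>F i in sequentially. r i < 1" using r(2) by (rule order_tendstoD) simp
    then have "\<forall>\<^sub>F i in sequentially. R i \<le> L * r i"
    proof eventually_elim
      case (elim i)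
      have "R i ^ ?d \<le> a * r i ^ ?d" using a(2)[OF r(1) elim] by (simp add: fR)
      also have "\<dots> \<le> (L * r i) ^ ?d"
        using L r(1)[of i] by (simp add: power_mult_distrib)
      finally show ?case using R[of i] r(1)[of i] L(1) by (subst (asm) power_mono_iff) auto
    qed
    then have "negligible (- limsup (\<lambda>i. cball (c i) (r i)))"
      by (rule limsup_full_if_dilates_full[OF r L(1) _ full])
    then show ?thesis
      by (rule hausdorff_measure_Int_eq_if_negligible_Compl[OF _ zero_less_one a])
  qed
qed

theorem theorem2:
  fixes c :: "nat \<Rightarrow> real ^ 'n"
    and \<rho> :: "nat \<Rightarrow> real"
    and f :: "real \<Rightarrow> real"
  assumes "\<And>i. \<rho> i > 0"
    and "\<rho> \<longlonglongrightarrow> 0"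
    and "dimension_function f"
    and "mono_on {0<..} (\<lambda>x. f x / x ^ CARD('n)) \<or> antimono_on {0<..} (\<lambda>x. f x / x ^ CARD('n))"
    and "\<And>(x :: real ^ 'n) r. r > 0 \<Longrightarrow>
           hausdorff_measure (\<lambda>t. t ^ CARD('n))
             (cball x r \<inter> limsup (\<lambda>i. transformed_ball f (c i) (\<rho> i)))
           = hausdorff_measure (\<lambda>t. t ^ CARD('n)) (cball x r)"
  shows "\<forall>(x :: real ^ 'n) r. r > 0 \<longrightarrow>
           hausdorff_measure f
             (cball x r \<inter> limsup (\<lambda>i. transformed_ball (\<lambda>t. t ^ CARD('n)) (c i) (\<rho> i)))
           = hausdorff_measure f (cball x r)"
proof (intro allI impI)
  fix x :: "real ^ 'n" and q :: real
  assume q: "q > 0"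
  define R where "R = (\<lambda>i. f (\<rho> i) powr (1 / real CARD('n)))"
  have f_pos: "f (\<rho> i) > 0" for i
    using assms(1,3) by (simp add: dimension_function_def)
  have R: "R i > 0" "R i ^ CARD('n) = f (\<rho> i)" for i
    using f_pos[of i] by (simp_all add: R_def powr_powr flip: powr_realpow)
  have full: "negligible (- limsup (\<lambda>i. cball (c i) (R i)))"
    using assms(5) by (intro negligible_Compl_if_full_hausdorff_measure limsup_cball_borel)
      (simp add: transformed_ball_def R_def)
  have "hausdorff_measure f (cball x q \<inter> limsup (\<lambda>i. cball (c i) (\<rho> i))) = hausdorff_measure f (cball x q)"
    by (rule mass_transference[OF assms(1-3) _ R(1) _ full q]) (use assms(4) R(2) in simp_all)
  then show "hausdorff_measure f
             (cball x q \<inter> limsup (\<lambda>i. transformed_ball (\<lambda>t. t ^ CARD('n)) (c i) (\<rho> i)))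
           = hausdorff_measure f (cball x q)"
    using assms(1) by (simp add: transformed_ball_power)
qed

end
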